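(* Let $(V,G)$ be a finite pseudo reflection group and let $\Upsilon=\{\mu_s\}_{s\in R}\cup\{m_i\}_{i\in P}$ be admissible complex parameters. Then the algebra $B_G(\Upsilon)$ is finite dimensional over $\mathbb{C}$, and the map $w\mapsto\bar w$ ($w\in G$) induces an injective algebra homomorphism $\mathbb{C}G\to B_G(\Upsilon)$.
   Context: A pseudo reflection of a finite dimensional complex vector space $V$ is a non-identity element of $GL(V)$ of finite order fixing pointwise a hyperplane; a finite pseudo reflection group $(V,G)$ is a finite subgroup $G\subset GL(V)$ generated by pseudo reflections. $R$ is the set of pseudo reflections in $G$; $\{H_i\}_{i\in P}$ is the set of their fixed hyperplanes, indexed bijectively by $P$. For $i,j\in P$ put $R(i,j)=\{s\in R: s(H_j)=H_i\}$. Admissible parameters: $\mu_s\in\mathbb{C}$ ($s\in R$) with $\mu_{s_1}=\mu_{s_2}$ if $s_1,s_2$ are conjugate in $G$, and $m_i\in\mathbb{C}$ ($i\in P$) with $m_i=m_j$ if $w(H_i)=H_j$ for some $w\in G$. $B_G(\Upsilon)$ is the unital associative $\mathbb{C}$-algebra generated by $\{\bar w\}_{w\in G}\cup\{e_i\}_{i\in P}$ with relations: (0) $\bar w_1\bar w_2=\bar w_3$ if $w_1w_2=w_3$ in $G$ (and $\bar 1$ is the unit); (1) $\bar s_ie_i=e_i\bar s_i=e_i$ for $i\in P$ and any pseudo reflection $s_i\in G$ with reflection hyperplane $H_i$; (2) $e_i^2=m_ie_i$; (3) $\bar we_j=e_i\bar w$ if $w\in G$ satisfies $w(H_j)=H_i$;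 and for $i\ne j$: (4) $e_ie_j=e_je_i$ if $\{k\in P: H_k\supset H_i\cap H_j\}=\{i,j\}$; (5) $e_ie_j=\big(\sum_{s\in R(i,j)}\mu_s\bar s\big)e_j$ if $\{k\in P: H_k\supset H_i\cap H_j\}\ne\{i,j\}$ and $R(i,j)\neq\emptyset$; (6) $e_ie_j=0$ if $\{k\in P: H_k\supset H_i\cap H_j\}\neq\{i,j\}$ and $R(i,j)=\emptyset$. *)

theory Defs
  imports Complex_Main "HOL-Library.Poly_Mapping" "HOL-Algebra.QuotRing" "HOL-Algebra.Module"
    "HOL-Algebra.Embedded_Algebras" "HOL-Algebra.Generated_Groups"
begin

section \<open>Finite pseudo reflection groups\<close>

text \<open>
  The space \<open>V\<close> is a whole type \<open>'v\<close> with an explicit complex scalar multiplication, which allows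
  every finite dimension, including 0.
\<close>

definition finite_dimensional_space :: "(complex \<Rightarrow> 'v::ab_group_add \<Rightarrow> 'v) \<Rightarrow> bool" where
  "finite_dimensional_space scale \<longleftrightarrow> (\<exists>Basis. finite_dimensional_vector_space scale Basis)"

definition GL :: "(complex \<Rightarrow> 'v::ab_group_add \<Rightarrow> 'v) \<Rightarrow> ('v \<Rightarrow> 'v) monoid" where
  "GL scale =
     \<lparr>carrier = {f. Vector_Spaces.linear scale scale f \<and> bij f}, monoid.mult = (\<circ>), one = id\<rparr>"

definition pseudo_reflection :: "(complex \<Rightarrow> 'v::ab_group_add \<Rightarrow> 'v) \<Rightarrow> ('v \<Rightarrow> 'v) \<Rightarrow> bool" where
  "pseudo_reflection scale s \<longleftrightarrow>
     s \<in> carrier (GL scale) \<and> s \<noteq> id \<and> (\<exists>n>0. s ^^ n = id) \<and>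
     (\<exists>U. module.subspace scale U
          \<and> Suc (vector_space.dim scale U) = vector_space.dim scale (UNIV :: 'v set)
          \<and> (\<forall>v\<in>U. s v = v))"

definition pseudo_reflections ::
    "(complex \<Rightarrow> 'v::ab_group_add \<Rightarrow> 'v) \<Rightarrow> ('v \<Rightarrow> 'v) set \<Rightarrow> ('v \<Rightarrow> 'v) set" where
  "pseudo_reflections scale G = {s \<in> G. pseudo_reflection scale s}"

definition finite_pseudo_reflection_group ::
    "(complex \<Rightarrow> 'v::ab_group_add \<Rightarrow> 'v) \<Rightarrow> ('v \<Rightarrow> 'v) set \<Rightarrow> bool" where
  "finite_pseudo_reflection_group scale G \<longleftrightarrow>
     finite_dimensional_space scale \<and> subgroup G (GL scale) \<and> finite G \<and>
     G = generate (GL scale) (pseudo_reflections scale G)"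

text \<open>
  For a pseudo reflection, which is not the identity, the space of all fixed vectors is exactly
  its fixed hyperplane.
\<close>

definition fixed_space :: "('v \<Rightarrow> 'v) \<Rightarrow> 'v set" where
  "fixed_space s = {v. s v = v}"

definition reflection_hyperplanes ::
    "(complex \<Rightarrow> 'v::ab_group_add \<Rightarrow> 'v) \<Rightarrow> ('v \<Rightarrow> 'v) set \<Rightarrow> 'v set set" where
  "reflection_hyperplanes scale G = fixed_space ` pseudo_reflections scale G"

definition reflections_between ::
    "(complex \<Rightarrow> 'v::ab_group_add \<Rightarrow> 'v) \<Rightarrow> ('v \<Rightarrow> 'v) set \<Rightarrow> ('p \<Rightarrow> 'v set) \<Rightarrow>
     'p \<Rightarrow> 'p \<Rightarrow> ('v \<Rightarrow> 'v) set" where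
  "reflections_between scale G H i j = {s \<in> pseudo_reflections scale G. s ` H j = H i}"

definition admissible_parameters ::
    "(complex \<Rightarrow> 'v::ab_group_add \<Rightarrow> 'v) \<Rightarrow> ('v \<Rightarrow> 'v) set \<Rightarrow> 'p set \<Rightarrow> ('p \<Rightarrow> 'v set) \<Rightarrow>
     (('v \<Rightarrow> 'v) \<Rightarrow> complex) \<Rightarrow> ('p \<Rightarrow> complex) \<Rightarrow> bool" where
  "admissible_parameters scale G P H \<mu> m \<longleftrightarrow>
     (\<forall>s1\<in>pseudo_reflections scale G. \<forall>s2\<in>pseudo_reflections scale G.
        (\<exists>g\<in>G. s2 = g \<otimes>\<^bsub>GL scale\<^esub> s1 \<otimes>\<^bsub>GL scale\<^esub> inv\<^bsub>GL scale\<^esub> g) \<longrightarrow> \<mu> s1 = \<mu> s2) \<and>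
     (\<forall>i\<in>P. \<forall>j\<in>P. (\<exists>w\<in>G. w ` H i = H j) \<longrightarrow> m i = m j)"


section \<open>Complex algebras by generators and relations\<close>

text \<open>
  A complex algebra is represented by the record type of HOL-Algebra modules, which carries
  a multiplication and a unit besides the scalar multiplication.

  The monoid algebra consists of the finitely supported functions on the carrier of the monoid;
  \<open>Poly_Mapping.single a 1\<close> is the basis element of \<open>a\<close>.
\<close>

definition monoid_algebra :: "('a, 'b) monoid_scheme \<Rightarrow> (complex, 'a \<Rightarrow>\<^sub>0 complex) module" where
  "monoid_algebra M =
     \<lparr>carrier = {f. Poly_Mapping.keys f \<subseteq> carrier M},
      monoid.mult = (\<lambda>f g. \<Sum>a\<in>Poly_Mapping.keys f. \<Sum>b\<in>Poly_Mapping.keys g.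
                Poly_Mapping.single (a \<otimes>\<^bsub>M\<^esub> b) (Poly_Mapping.lookup f a * Poly_Mapping.lookup g b)),
      one = Poly_Mapping.single \<one>\<^bsub>M\<^esub> 1,
      ring.zero = 0,
      ring.add = (+),
      module.smult = (\<lambda>c. Poly_Mapping.map ((*) c))\<rparr>"

definition free_monoid :: "'a set \<Rightarrow> 'a list monoid" where
  "free_monoid X = \<lparr>carrier = {xs. set xs \<subseteq> X}, monoid.mult = (@), one = []\<rparr>"

definition free_algebra :: "'a set \<Rightarrow> (complex, 'a list \<Rightarrow>\<^sub>0 complex) module" where
  "free_algebra X = monoid_algebra (free_monoid X)"

definition free_gen :: "'a \<Rightarrow> 'a list \<Rightarrow>\<^sub>0 complex" where
  "free_gen x = Poly_Mapping.single [x] 1"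

text \<open>
  Multiplication, unit, zero and addition are those of \<open>A Quot I\<close>; the scalar multiplication
  follows the same pattern as \<^const>\<open>rcoset_mult\<close>.
\<close>

definition quotient_algebra ::
    "(complex, 'a) module \<Rightarrow> 'a set \<Rightarrow> (complex, 'a set) module" where
  "quotient_algebra A I =
     \<lparr>carrier = carrier (A Quot I), monoid.mult = monoid.mult (A Quot I), one = \<one>\<^bsub>A Quot I\<^esub>,
      ring.zero = \<zero>\<^bsub>A Quot I\<^esub>, ring.add = ring.add (A Quot I),
      module.smult = (\<lambda>c Y. \<Union>y\<in>Y. I +>\<^bsub>A\<^esub> (c \<odot>\<^bsub>A\<^esub> y))\<rparr>"

text \<open>A relation \<open>l = r\<close> is given as the pair \<open>(l, r)\<close>; ideals in HOL-Algebra are two-sided.\<close>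

definition relation_ideal ::
    "'a set \<Rightarrow> (('a list \<Rightarrow>\<^sub>0 complex) \<times> ('a list \<Rightarrow>\<^sub>0 complex)) set \<Rightarrow> ('a list \<Rightarrow>\<^sub>0 complex) set" where
  "relation_ideal X S =
     Idl\<^bsub>free_algebra X\<^esub> {l \<ominus>\<^bsub>free_algebra X\<^esub> r | l r. (l, r) \<in> S}"

definition presented_algebra ::
    "'a set \<Rightarrow> (('a list \<Rightarrow>\<^sub>0 complex) \<times> ('a list \<Rightarrow>\<^sub>0 complex)) set \<Rightarrow>
     (complex, ('a list \<Rightarrow>\<^sub>0 complex) set) module" where
  "presented_algebra X S = quotient_algebra (free_algebra X) (relation_ideal X S)"

definition presented_gen ::
    "'a set \<Rightarrow> (('a list \<Rightarrow>\<^sub>0 complex) \<times> ('a list \<Rightarrow>\<^sub>0 complex)) set \<Rightarrow> 'a \<Rightarrow>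
     ('a list \<Rightarrow>\<^sub>0 complex) set" where
  "presented_gen X S x = relation_ideal X S +>\<^bsub>free_algebra X\<^esub> free_gen x"

definition algebra_hom :: "(complex, 'a) module \<Rightarrow> (complex, 'b) module \<Rightarrow> ('a \<Rightarrow> 'b) set" where
  "algebra_hom A B =
     {\<phi> \<in> ring_hom A B. \<forall>c. \<forall>x\<in>carrier A. \<phi> (c \<odot>\<^bsub>A\<^esub> x) = c \<odot>\<^bsub>B\<^esub> \<phi> x}"

text \<open>
  The library measures dimension over a subfield of the ring; for a nonzero complex algebra the
  subfield is the image of the complex numbers.
\<close>

definition scalars :: "(complex, 'a) module \<Rightarrow> 'a set" where
  "scalars A = range (\<lambda>c. c \<odot>\<^bsub>A\<^esub> \<one>\<^bsub>A\<^esub>)"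

definition finite_dimensional_algebra :: "(complex, 'a) module \<Rightarrow> bool" where
  "finite_dimensional_algebra A \<longleftrightarrow> ring.finite_dimension A (scalars A) (carrier A)"


section \<open>The algebra \<open>B\<^sub>G(\<Upsilon>)\<close>\<close>

datatype ('g, 'p) generator = W 'g | E 'p

definition generators :: "'g set \<Rightarrow> 'p set \<Rightarrow> ('g, 'p) generator set" where
  "generators G P = W ` G \<union> E ` P"

abbreviation w_gen :: "'g \<Rightarrow> ('g, 'p) generator list \<Rightarrow>\<^sub>0 complex" where
  "w_gen w \<equiv> free_gen (W w)"

abbreviation e_gen :: "'p \<Rightarrow> ('g, 'p) generator list \<Rightarrow>\<^sub>0 complex" where
  "e_gen i \<equiv> free_gen (E i)"

definition hyperplanes_above :: "'p set \<Rightarrow> ('p \<Rightarrow> 'v set) \<Rightarrow> 'p \<Rightarrow> 'p \<Rightarrow> 'p set" where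
  "hyperplanes_above P H i j = {k \<in> P. H i \<inter> H j \<subseteq> H k}"

inductive_set B_relations ::
    "(complex \<Rightarrow> 'v::ab_group_add \<Rightarrow> 'v) \<Rightarrow> ('v \<Rightarrow> 'v) set \<Rightarrow> 'p set \<Rightarrow> ('p \<Rightarrow> 'v set) \<Rightarrow>
     (('v \<Rightarrow> 'v) \<Rightarrow> complex) \<Rightarrow> ('p \<Rightarrow> complex) \<Rightarrow>
     ((('v \<Rightarrow> 'v, 'p) generator list \<Rightarrow>\<^sub>0 complex) \<times> (('v \<Rightarrow> 'v, 'p) generator list \<Rightarrow>\<^sub>0 complex)) set"
  for scale :: "complex \<Rightarrow> 'v::ab_group_add \<Rightarrow> 'v" and G :: "('v \<Rightarrow> 'v) set" and P :: "'p set"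
    and H :: "'p \<Rightarrow> 'v set" and \<mu> :: "('v \<Rightarrow> 'v) \<Rightarrow> complex" and m :: "'p \<Rightarrow> complex"
  where
    group_one:
      "(w_gen id, \<one>\<^bsub>free_algebra (generators G P)\<^esub>) \<in> B_relations scale G P H \<mu> m"
  | group_mult:
      "\<lbrakk>w1 \<in> G; w2 \<in> G\<rbrakk> \<Longrightarrow>
       (w_gen w1 \<otimes>\<^bsub>free_algebra (generators G P)\<^esub> w_gen w2, w_gen (w1 \<circ> w2))
         \<in> B_relations scale G P H \<mu> m"
  | absorb_left:
      "\<lbrakk>i \<in> P; s \<in> pseudo_reflections scale G; fixed_space s = H i\<rbrakk> \<Longrightarrow>
       (w_gen s \<otimes>\<^bsub>free_algebra (generators G P)\<^esub> e_gen i, e_gen i) \<in> B_relations scale G P H \<mu> m"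
  | absorb_right:
      "\<lbrakk>i \<in> P; s \<in> pseudo_reflections scale G; fixed_space s = H i\<rbrakk> \<Longrightarrow>
       (e_gen i \<otimes>\<^bsub>free_algebra (generators G P)\<^esub> w_gen s, e_gen i) \<in> B_relations scale G P H \<mu> m"
  | square:
      "i \<in> P \<Longrightarrow>
       (e_gen i \<otimes>\<^bsub>free_algebra (generators G P)\<^esub> e_gen i,
        m i \<odot>\<^bsub>free_algebra (generators G P)\<^esub> e_gen i) \<in> B_relations scale G P H \<mu> m"
  | conjugate:
      "\<lbrakk>i \<in> P; j \<in> P; w \<in> G; w ` H j = H i\<rbrakk> \<Longrightarrow>
       (w_gen w \<otimes>\<^bsub>free_algebra (generators G P)\<^esub> e_gen j,
        e_gen i \<otimes>\<^bsub>free_algebra (generators G P)\<^esub> w_gen w) \<in> B_relations scale G P H \<mu> m"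
  | commute:
      "\<lbrakk>i \<in> P; j \<in> P; i \<noteq> j; hyperplanes_above P H i j = {i, j}\<rbrakk> \<Longrightarrow>
       (e_gen i \<otimes>\<^bsub>free_algebra (generators G P)\<^esub> e_gen j,
        e_gen j \<otimes>\<^bsub>free_algebra (generators G P)\<^esub> e_gen i) \<in> B_relations scale G P H \<mu> m"
  | contract:
      "\<lbrakk>i \<in> P; j \<in> P; i \<noteq> j; hyperplanes_above P H i j \<noteq> {i, j};
        reflections_between scale G H i j \<noteq> {}\<rbrakk> \<Longrightarrow>
       (e_gen i \<otimes>\<^bsub>free_algebra (generators G P)\<^esub> e_gen j,
        (\<Oplus>\<^bsub>free_algebra (generators G P)\<^esub>s\<in>reflections_between scale G H i j.
            \<mu> s \<odot>\<^bsub>free_algebra (generators G P)\<^esub> w_gen s)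
          \<otimes>\<^bsub>free_algebra (generators G P)\<^esub> e_gen j) \<in> B_relations scale G P H \<mu> m"
  | annihilate:
      "\<lbrakk>i \<in> P; j \<in> P; i \<noteq> j; hyperplanes_above P H i j \<noteq> {i, j};
        reflections_between scale G H i j = {}\<rbrakk> \<Longrightarrow>
       (e_gen i \<otimes>\<^bsub>free_algebra (generators G P)\<^esub> e_gen j, \<zero>\<^bsub>free_algebra (generators G P)\<^esub>)
         \<in> B_relations scale G P H \<mu> m"

definition B_algebra ::
    "(complex \<Rightarrow> 'v::ab_group_add \<Rightarrow> 'v) \<Rightarrow> ('v \<Rightarrow> 'v) set \<Rightarrow> 'p set \<Rightarrow> ('p \<Rightarrow> 'v set) \<Rightarrow>
     (('v \<Rightarrow> 'v) \<Rightarrow> complex) \<Rightarrow> ('p \<Rightarrow> complex) \<Rightarrow>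
     (complex, (('v \<Rightarrow> 'v, 'p) generator list \<Rightarrow>\<^sub>0 complex) set) module" where
  "B_algebra scale G P H \<mu> m =
     presented_algebra (generators G P) (B_relations scale G P H \<mu> m)"

definition B_bar ::
    "(complex \<Rightarrow> 'v::ab_group_add \<Rightarrow> 'v) \<Rightarrow> ('v \<Rightarrow> 'v) set \<Rightarrow> 'p set \<Rightarrow> ('p \<Rightarrow> 'v set) \<Rightarrow>
     (('v \<Rightarrow> 'v) \<Rightarrow> complex) \<Rightarrow> ('p \<Rightarrow> complex) \<Rightarrow>
     ('v \<Rightarrow> 'v) \<Rightarrow> (('v \<Rightarrow> 'v, 'p) generator list \<Rightarrow>\<^sub>0 complex) set" where
  "B_bar scale G P H \<mu> m w =
     presented_gen (generators G P) (B_relations scale G P H \<mu> m) (W w)"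

definition group_algebra ::
    "(complex \<Rightarrow> 'v::ab_group_add \<Rightarrow> 'v) \<Rightarrow> ('v \<Rightarrow> 'v) set \<Rightarrow>
     (complex, ('v \<Rightarrow> 'v) \<Rightarrow>\<^sub>0 complex) module" where
  "group_algebra scale G = monoid_algebra (GL scale\<lparr>carrier := G\<rparr>)"

end

theory Submission
  imports Defs
begin

text \<open>
  Sending every \<open>e\<^sub>i\<close> to zero respects all relations, so it defines a retraction of \<open>B\<^sub>G(\<Upsilon>)\<close>
  onto the group algebra; this gives injectivity.  For finite dimension, relation (3) moves all group
  elements of a word to the left.  In a word \<open>e\<^bsub>i1\<^esub> \<dots> e\<^bsub>ir\<^esub>\<close> with a repeated index, the first
  of two equal letters is moved towards the second: each neighbour either commutes with it or, by (5)
  and (6), shortens the word, and when the two meet (2) shortens it.  Hence the elements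
  \<open>w e\<^bsub>i1\<^esub> \<dots> e\<^bsub>ir\<^esub>\<close> with distinct indices span.
\<close>

section \<open>Complex algebras\<close>

text \<open>Sending the \<open>e i\<close> to zero is harmless because only \<open>group_one\<close>
  and \<open>group_mult\<close> have terms free of \<open>e\<close>: in every other relation each
  monomial on either side contains some \<open>e i\<close>. The retraction also serves the dimension
  statement: dimension is measured over the multiples of the unit, which form a field only if the
  unit is nonzero, and the unit is nonzero because it maps to the unit of the group algebra. The
  obstacle in the reduction is that \<open>contract\<close> leaves group elements in the middle of a
  word. Moving them to the left changes the indices of the letters they pass, so the pattern of
  repetitions is not tracked. Only the length is: one letter has disappeared and none is created.
  Hence the reduction is an induction on length, and the shorter words may contain repetitions
  again. In \<open>contract\<close> the left letter disappears and its replacement stands to the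
  left of the surviving one, so the rest of the word is untouched. Moving group elements needs, for
  all i and w, an index j with w(H j) = H i; it exists because a conjugate of a pseudo reflection is
  a pseudo reflection.\<close>

locale complex_algebra = ring A for A :: "(complex, 'a) module" (structure) +
  assumes smult_closed [simp, intro]: "x \<in> carrier A \<Longrightarrow> c \<odot> x \<in> carrier A"
    and smult_add_left: "x \<in> carrier A \<Longrightarrow> (c + d) \<odot> x = c \<odot> x \<oplus> d \<odot> x"
    and smult_add_right: "\<lbrakk>x \<in> carrier A; y \<in> carrier A\<rbrakk> \<Longrightarrow> c \<odot> (x \<oplus> y) = c \<odot> x \<oplus> c \<odot> y"
    and smult_smult: "x \<in> carrier A \<Longrightarrow> c \<odot> (d \<odot> x) = (c * d) \<odot> x"
    and smult_one [simp]: "x \<in> carrier A \<Longrightarrow> 1 \<odot> x = x"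
    and mult_smult_left: "\<lbrakk>x \<in> carrier A; y \<in> carrier A\<rbrakk> \<Longrightarrow> (c \<odot> x) \<otimes> y = c \<odot> (x \<otimes> y)"
    and mult_smult_right: "\<lbrakk>x \<in> carrier A; y \<in> carrier A\<rbrakk> \<Longrightarrow> x \<otimes> (c \<odot> y) = c \<odot> (x \<otimes> y)"
begin

lemma smult_zero_left [simp]:
  assumes "x \<in> carrier A"
  shows "0 \<odot> x = \<zero>"
  using smult_add_left[OF assms, of 0 0] assms by (simp add: add.r_cancel_one')

lemma smult_zero_right [simp]: "c \<odot> \<zero> = \<zero>"
  using smult_add_right[of \<zero> \<zero> c] by (simp add: add.r_cancel_one')

end

lemma algebra_homI:
  assumes "\<phi> \<in> ring_hom A B" "\<And>c x. x \<in> carrier A \<Longrightarrow> \<phi> (c \<odot>\<^bsub>A\<^esub> x) = c \<odot>\<^bsub>B\<^esub> \<phi> x"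
  shows "\<phi> \<in> algebra_hom A B"
  using assms by (simp add: algebra_hom_def)

lemma algebra_homD:
  assumes "\<phi> \<in> algebra_hom A B"
  shows "\<phi> \<in> ring_hom A B"
    and "x \<in> carrier A \<Longrightarrow> \<phi> (c \<odot>\<^bsub>A\<^esub> x) = c \<odot>\<^bsub>B\<^esub> \<phi> x"
  using assms by (simp_all add: algebra_hom_def)

text \<open>Coefficients are complex numbers and not elements of a subfield of \<open>A\<close>, so
  the span makes sense before \<one> = \<zero> has been excluded. Scalars enter only through
  \<open>base\<close>, which keeps every induction to three cases; closure under scalar
  multiplication is derived.\<close>

inductive_set lspan :: "(complex, 'a) module \<Rightarrow> 'a set \<Rightarrow> 'a set"
  for A :: "(complex, 'a) module" (structure) and X :: "'a set" where
  zero: "\<zero> \<in> lspan A X"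
| base: "x \<in> X \<Longrightarrow> c \<odot> x \<in> lspan A X"
| add: "\<lbrakk>x \<in> lspan A X; y \<in> lspan A X\<rbrakk> \<Longrightarrow> x \<oplus> y \<in> lspan A X"

context complex_algebra
begin

lemma lspan_in_carrier:
  assumes "X \<subseteq> carrier A" "v \<in> lspan A X"
  shows "v \<in> carrier A"
  using assms(2) by induction (use assms(1) in auto)

lemma lspan_superset:
  assumes "X \<subseteq> carrier A" "x \<in> X"
  shows "x \<in> lspan A X"
  using lspan.base[OF assms(2), of A 1] assms by auto

lemma lspan_smult:
  assumes "X \<subseteq> carrier A" "v \<in> lspan A X"
  shows "c \<odot> v \<in> lspan A X"
  using assms(2)
proof induction
  case (base x d)
  then have "x \<in> carrier A" using assms(1) by blast
  with base show ?case by (simp add: smult_smult lspan.base)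
next
  case (add x y)
  then show ?case using assms(1) by (auto simp: smult_add_right lspan_in_carrier intro: lspan.add)
qed (simp add: lspan.zero)

lemma lspan_finsum:
  assumes "X \<subseteq> carrier A" "\<And>i. i \<in> I \<Longrightarrow> f i \<in> lspan A X"
  shows "finsum A f I \<in> lspan A X"
  using assms(2)
proof (induction I rule: infinite_finite_induct)
  case (insert i I)
  then have "f \<in> I \<rightarrow> carrier A" "f i \<in> carrier A"
    using assms(1) lspan_in_carrier by auto
  with insert show ?case by (simp add: lspan.add)
qed (auto simp: lspan.zero)

text \<open>By linearity a product with a span need only be controlled on the spanning elements. The
  target \<open>Y\<close> is separate from \<open>X\<close> because multiplying by a generator can
  lengthen words.\<close>

lemma lspan_mult_left:
  assumes "X \<subseteq> carrier A" "Y \<subseteq> carrier A" "a \<in> carrier A"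
    and "\<And>x. x \<in> X \<Longrightarrow> a \<otimes> x \<in> lspan A Y" and "v \<in> lspan A X"
  shows "a \<otimes> v \<in> lspan A Y"
  using assms(5)
proof induction
  case (base x c)
  then have "x \<in> carrier A" using assms(1) by blast
  with base show ?case using assms by (simp add: mult_smult_right lspan_smult)
next
  case (add x y)
  then show ?case using assms by (auto simp: r_distr lspan_in_carrier intro: lspan.add)
qed (simp add: lspan.zero assms)

lemma lspan_mult_right:
  assumes "X \<subseteq> carrier A" "Y \<subseteq> carrier A" "a \<in> carrier A"
    and "\<And>x. x \<in> X \<Longrightarrow> x \<otimes> a \<in> lspan A Y" and "v \<in> lspan A X"
  shows "v \<otimes> a \<in> lspan A Y"
  using assms(5)
proof induction
  case (base x c)
  then have "x \<in> carrier A" using assms(1) by blast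
  with base show ?case using assms by (simp add: mult_smult_left lspan_smult)
next
  case (add x y)
  then show ?case using assms by (auto simp: l_distr lspan_in_carrier intro: lspan.add)
qed (simp add: lspan.zero assms)

lemma lspan_minimal:
  assumes "Y \<subseteq> carrier A" "X \<subseteq> lspan A Y"
  shows "lspan A X \<subseteq> lspan A Y"
proof
  fix v assume "v \<in> lspan A X"
  then show "v \<in> lspan A Y"
    by induction (use assms lspan_smult in \<open>auto intro: lspan.intros\<close>)
qed

end

lemma algebra_hom_image_lspan:
  assumes "complex_algebra A" "complex_algebra B" "\<phi> \<in> algebra_hom A B"
    and "X \<subseteq> carrier A" "v \<in> lspan A X"
  shows "\<phi> v \<in> lspan B (\<phi> ` X)"
proof -
  interpret A: complex_algebra A by fact
  interpret B: complex_algebra B by fact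
  note hom = algebra_homD[OF assms(3)]
  show ?thesis
    using assms(5)
  proof induction
    case zero
    then show ?case
      using ring_hom_zero[OF hom(1) A.ring_axioms B.ring_axioms] by (simp add: lspan.zero)
  next
    case (base x c)
    then have "\<phi> (c \<odot>\<^bsub>A\<^esub> x) = c \<odot>\<^bsub>B\<^esub> \<phi> x" using assms(4) by (intro hom(2)) blast
    with base show ?case by (simp add: lspan.base)
  next
    case (add x y)
    then show ?case
      using ring_hom_add[OF hom(1)] A.lspan_in_carrier[OF assms(4)] by (simp add: lspan.add)
  qed
qed

lemma algebra_hom_eq_on_lspan:
  assumes "complex_algebra A" "complex_algebra B" "\<phi> \<in> algebra_hom A B" "\<psi> \<in> algebra_hom A B"
    and "X \<subseteq> carrier A" "\<And>x. x \<in> X \<Longrightarrow> \<phi> x = \<psi> x" "v \<in> lspan A X"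
  shows "\<phi> v = \<psi> v"
proof -
  interpret A: complex_algebra A by fact
  interpret B: complex_algebra B by fact
  note \<phi> = algebra_homD[OF assms(3)] and \<psi> = algebra_homD[OF assms(4)]
  show ?thesis
    using assms(7)
  proof induction
    case zero
    then show ?case
      using ring_hom_zero[OF \<phi>(1) A.ring_axioms B.ring_axioms]
        ring_hom_zero[OF \<psi>(1) A.ring_axioms B.ring_axioms] by simp
  next
    case (base x c)
    then show ?case using assms(5,6) by (auto simp: \<phi>(2) \<psi>(2) subset_iff)
  next
    case (add x y)
    then show ?case
      using ring_hom_add[OF \<phi>(1)] ring_hom_add[OF \<psi>(1)] A.lspan_in_carrier[OF assms(5)] by simp
  qed
qed

section \<open>The scalars as a subfield, and finite dimension\<close>

definition complex_field :: "complex ring" where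
  "complex_field = \<lparr>carrier = UNIV, monoid.mult = (*), one = 1, ring.zero = 0, ring.add = (+)\<rparr>"

lemma field_complex_field: "field complex_field"
proof -
  have "cring complex_field"
    by (rule cringI, rule abelian_groupI)
      (auto simp: complex_field_def algebra_simps intro!: comm_monoidI exI[of _ "- x" for x])
  then interpret cring complex_field .
  show ?thesis
  proof (rule cring_fieldI2)
    fix a assume "a \<in> carrier complex_field" "a \<noteq> \<zero>\<^bsub>complex_field\<^esub>"
    then show "\<exists>b\<in>carrier complex_field. a \<otimes>\<^bsub>complex_field\<^esub> b = \<one>\<^bsub>complex_field\<^esub>"
      by (intro bexI[of _ "inverse a"]) (auto simp: complex_field_def)
  qed (simp add: complex_field_def)
qed

context complex_algebra
begin

text \<open>The scalars are the image of the field of complex numbers under the ring homomorphism c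
  \<mapsto> c \<odot> \<one>, and the image of a field is a subfield when the target is nontrivial.
  \<open>complex_field\<close> exists to be the source of this homomorphism.\<close>

lemma subfield_scalars:
  assumes "\<one> \<noteq> \<zero>"
  shows "subfield (scalars A) A"
proof -
  interpret C: field complex_field by (rule field_complex_field)
  have "(\<lambda>c. c \<odot> \<one>) \<in> ring_hom complex_field A"
    by (rule ring_hom_memI)
      (auto simp: complex_field_def smult_add_left mult_smult_left smult_smult)
  then interpret ring_hom_ring complex_field A "\<lambda>c. c \<odot> \<one>"
    by (intro ring_hom_ringI2 C.ring_axioms ring_axioms)
  show ?thesis
    using img_is_subfield(2)[OF C.carrier_is_subfield assms]
    by (simp add: scalars_def complex_field_def)
qed

lemma finite_dimensional_algebraI:
  assumes "\<one> \<noteq> \<zero>" "finite X" "X \<subseteq> carrier A" "carrier A \<subseteq> lspan A X"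
  shows "finite_dimensional_algebra A"
proof -
  obtain Us where Us: "set Us = X" using finite_list[OF assms(2)] by blast
  then have Us': "set Us \<subseteq> carrier A" using assms(3) by simp
  note sf = subfield_scalars[OF assms(1)]
  have "v \<in> Span (scalars A) Us" if "v \<in> lspan A X" for v
    using that
  proof induction
    case zero
    then show ?case using Span_subgroup_props(2)[OF sf Us'] by blast
  next
    case (base x c)
    then have x: "x \<in> carrier A" "x \<in> Span (scalars A) Us"
      using Span_base_incl[OF sf Us'] Us assms(3) by auto
    \<comment> \<open>\<open>Span\<close> knows only ring multiplication by elements of the
      subfield, so c \<odot> x is written as the product of c \<odot> \<one> and x.\<close>
    have "(c \<odot> \<one>) \<otimes> x \<in> Span (scalars A) Us"
      using Span_smult_closed[OF sf Us' _ x(2)] by (simp add: scalars_def)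
    then show ?case using x(1) by (simp add: mult_smult_left)
  next
    case (add x y)
    then show ?case using Span_subgroup_props(3)[OF sf Us'] by blast
  qed
  then have "Span (scalars A) Us = carrier A"
    using assms(4) Span_subgroup_props(1)[OF sf Us'] by blast
  then show ?thesis
    using Span_finite_dimension[OF sf Us'] by (simp add: finite_dimensional_algebra_def)
qed

end

section \<open>Monoid algebras\<close>

lemma monoid_algebra_simps [simp]:
  "f \<in> carrier (monoid_algebra M) \<longleftrightarrow> Poly_Mapping.keys f \<subseteq> carrier M"
  "\<one>\<^bsub>monoid_algebra M\<^esub> = Poly_Mapping.single \<one>\<^bsub>M\<^esub> 1"
  "\<zero>\<^bsub>monoid_algebra M\<^esub> = 0"
  "f \<oplus>\<^bsub>monoid_algebra M\<^esub> g = f + g"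
  "c \<odot>\<^bsub>monoid_algebra M\<^esub> f = Poly_Mapping.map ((*) c) f"
  by (simp_all add: monoid_algebra_def)

lemma lookup_map_mult [simp]:
  fixes f :: "'a \<Rightarrow>\<^sub>0 complex"
  shows "Poly_Mapping.lookup (Poly_Mapping.map ((*) c) f) a = c * Poly_Mapping.lookup f a"
  by (simp add: Poly_Mapping.map.rep_eq when_def)

lemma map_mult_single [simp]:
  fixes d :: complex
  shows "Poly_Mapping.map ((*) c) (Poly_Mapping.single a d) = Poly_Mapping.single a (c * d)"
  by (rule poly_mapping_eqI) (simp add: lookup_single when_def)

lemma map_mult_add:
  fixes f g :: "'a \<Rightarrow>\<^sub>0 complex"
  shows "Poly_Mapping.map ((*) c) (f + g) = Poly_Mapping.map ((*) c) f + Poly_Mapping.map ((*) c) g"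
  by (rule poly_mapping_eqI) (simp add: lookup_add algebra_simps)

lemma map_mult_sum:
  fixes F :: "'b \<Rightarrow> 'a \<Rightarrow>\<^sub>0 complex"
  shows "Poly_Mapping.map ((*) c) (sum F S) = (\<Sum>a\<in>S. Poly_Mapping.map ((*) c) (F a))"
  by (rule poly_mapping_eqI) (simp add: lookup_sum sum_distrib_left)

lemma keys_map_mult: "Poly_Mapping.keys (Poly_Mapping.map ((*) c) f) \<subseteq> Poly_Mapping.keys f"
  for f :: "'a \<Rightarrow>\<^sub>0 complex"
  by (auto simp: in_keys_iff)

lemma keys_add_subset:
  "\<lbrakk>Poly_Mapping.keys f \<subseteq> S; Poly_Mapping.keys g \<subseteq> S\<rbrakk> \<Longrightarrow> Poly_Mapping.keys (f + g) \<subseteq> S"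
  using Poly_Mapping.keys_add[of f g] by blast

lemma sum_single_lookup: "f = (\<Sum>a\<in>Poly_Mapping.keys f. Poly_Mapping.single a (Poly_Mapping.lookup f a))"
  by (rule poly_mapping_eqI) (simp add: lookup_sum lookup_single when_def in_keys_iff)

lemma monoid_algebra_induct [consumes 1, case_names zero single add]:
  fixes f :: "'a \<Rightarrow>\<^sub>0 complex"
  assumes "f \<in> carrier (monoid_algebra M)" and "P 0"
    and "\<And>a c. a \<in> carrier M \<Longrightarrow> P (Poly_Mapping.single a c)"
    and "\<And>f g. \<lbrakk>f \<in> carrier (monoid_algebra M); g \<in> carrier (monoid_algebra M); P f; P g\<rbrakk> \<Longrightarrow> P (f + g)"
  shows "P f"
proof -
  \<comment> \<open>Arbitrary finite \<open>K\<close> and coefficients \<open>h\<close> allow an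
    induction on \<open>K\<close> that never touches a support. Membership in the carrier is carried
    along because the hypothesis on sums asks for it.\<close>
  have "(\<Sum>a\<in>K. Poly_Mapping.single a (h a)) \<in> carrier (monoid_algebra M)
      \<and> P (\<Sum>a\<in>K. Poly_Mapping.single a (h a))"
    if "finite K" "K \<subseteq> carrier M" for K and h :: "'a \<Rightarrow> complex"
    using that
  proof (induction K)
    case (insert a K)
    let ?f = "Poly_Mapping.single a (h a)" and ?g = "\<Sum>a\<in>K. Poly_Mapping.single a (h a)"
    have "?f \<in> carrier (monoid_algebra M)" "P ?f"
      using insert.prems assms(3) by simp_all
    moreover have "?g \<in> carrier (monoid_algebra M)" "P ?g"
      using insert by auto
    ultimately have "?f + ?g \<in> carrier (monoid_algebra M) \<and> P (?f + ?g)"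
      using assms(4)[of ?f ?g] keys_add_subset[of ?f _ ?g] by simp
    then show ?case using insert.hyps by simp
  qed (simp add: assms(2))
  from this[of "Poly_Mapping.keys f" "Poly_Mapping.lookup f"] show ?thesis
    using assms(1) sum_single_lookup[of f] by simp
qed

text \<open>The product is defined by sums over the exact supports, and the support of a sum may
  shrink by cancellation. Padding with zero coefficients to fixed index sets makes bilinearity a
  termwise matter.\<close>

lemma mult_monoid_algebra_eq:
  assumes "finite S" "Poly_Mapping.keys f \<subseteq> S" "finite T" "Poly_Mapping.keys g \<subseteq> T"
  shows "f \<otimes>\<^bsub>monoid_algebra M\<^esub> g = (\<Sum>a\<in>S. \<Sum>b\<in>T.
    Poly_Mapping.single (a \<otimes>\<^bsub>M\<^esub> b) (Poly_Mapping.lookup f a * Poly_Mapping.lookup g b))"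
proof -
  have "f \<otimes>\<^bsub>monoid_algebra M\<^esub> g = (\<Sum>a\<in>Poly_Mapping.keys f. \<Sum>b\<in>T.
      Poly_Mapping.single (a \<otimes>\<^bsub>M\<^esub> b) (Poly_Mapping.lookup f a * Poly_Mapping.lookup g b))"
    using assms unfolding monoid_algebra_def monoid.simps
    by (intro sum.cong refl sum.mono_neutral_left) (auto simp: in_keys_iff)
  also have "\<dots> = (\<Sum>a\<in>S. \<Sum>b\<in>T.
      Poly_Mapping.single (a \<otimes>\<^bsub>M\<^esub> b) (Poly_Mapping.lookup f a * Poly_Mapping.lookup g b))"
    using assms by (intro sum.mono_neutral_left) (auto simp: in_keys_iff)
  finally show ?thesis .
qed

lemma mult_single_single [simp]:
  "Poly_Mapping.single a c \<otimes>\<^bsub>monoid_algebra M\<^esub> Poly_Mapping.single b d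
    = Poly_Mapping.single (a \<otimes>\<^bsub>M\<^esub> b) (c * d)"
  by (subst mult_monoid_algebra_eq[of "{a}" _ "{b}"]) auto

lemma mult_monoid_algebra_add_left:
  "(f + g) \<otimes>\<^bsub>monoid_algebra M\<^esub> h = f \<otimes>\<^bsub>monoid_algebra M\<^esub> h + g \<otimes>\<^bsub>monoid_algebra M\<^esub> h"
  by (simp add: mult_monoid_algebra_eq[of "Poly_Mapping.keys f \<union> Poly_Mapping.keys g" _ "Poly_Mapping.keys h"]
      Poly_Mapping.keys_add lookup_add distrib_right single_add sum.distrib)

lemma mult_monoid_algebra_add_right:
  "h \<otimes>\<^bsub>monoid_algebra M\<^esub> (f + g) = h \<otimes>\<^bsub>monoid_algebra M\<^esub> f + h \<otimes>\<^bsub>monoid_algebra M\<^esub> g"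
  by (simp add: mult_monoid_algebra_eq[of "Poly_Mapping.keys h" _ "Poly_Mapping.keys f \<union> Poly_Mapping.keys g"]
      Poly_Mapping.keys_add lookup_add distrib_left single_add sum.distrib)

lemma mult_monoid_algebra_zero [simp]:
  "0 \<otimes>\<^bsub>monoid_algebra M\<^esub> f = 0" "f \<otimes>\<^bsub>monoid_algebra M\<^esub> 0 = 0"
  by (simp_all add: monoid_algebra_def)

lemma mult_map_mult_left:
  "Poly_Mapping.map ((*) c) f \<otimes>\<^bsub>monoid_algebra M\<^esub> g = Poly_Mapping.map ((*) c) (f \<otimes>\<^bsub>monoid_algebra M\<^esub> g)"
  by (simp add: mult_monoid_algebra_eq[of "Poly_Mapping.keys f" _ "Poly_Mapping.keys g"]
      keys_map_mult map_mult_sum mult.assoc)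

lemma mult_map_mult_right:
  "f \<otimes>\<^bsub>monoid_algebra M\<^esub> Poly_Mapping.map ((*) c) g = Poly_Mapping.map ((*) c) (f \<otimes>\<^bsub>monoid_algebra M\<^esub> g)"
  by (simp add: mult_monoid_algebra_eq[of "Poly_Mapping.keys f" _ "Poly_Mapping.keys g"]
      keys_map_mult map_mult_sum mult.left_commute)

context monoid
begin

lemma mult_monoid_algebra_closed:
  assumes "f \<in> carrier (monoid_algebra G)" "g \<in> carrier (monoid_algebra G)"
  shows "f \<otimes>\<^bsub>monoid_algebra G\<^esub> g \<in> carrier (monoid_algebra G)"
  using assms(1)
proof (induction f rule: monoid_algebra_induct)
  case (single a c)
  show ?case
    using assms(2)
  proof (induction g rule: monoid_algebra_induct)
    case (add g h)
    then show ?case by (simp add: mult_monoid_algebra_add_right keys_add_subset)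
  qed (use single in auto)
qed (auto simp: mult_monoid_algebra_add_left keys_add_subset)

lemma mult_monoid_algebra_assoc:
  assumes "f \<in> carrier (monoid_algebra G)" "g \<in> carrier (monoid_algebra G)"
    and "h \<in> carrier (monoid_algebra G)"
  shows "f \<otimes>\<^bsub>monoid_algebra G\<^esub> g \<otimes>\<^bsub>monoid_algebra G\<^esub> h
    = f \<otimes>\<^bsub>monoid_algebra G\<^esub> (g \<otimes>\<^bsub>monoid_algebra G\<^esub> h)"
  using assms(1)
proof (induction f rule: monoid_algebra_induct)
  case (single a c)
  show ?case
    using assms(2)
  proof (induction g rule: monoid_algebra_induct)
    case (single b d)
    show ?case
      using assms(3)
    proof (induction h rule: monoid_algebra_induct)
      case (single x e)
      then show ?case using \<open>a \<in> carrier G\<close> \<open>b \<in> carrier G\<close> by (simp add: m_assoc mult.assoc)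
    qed (simp_all add: mult_monoid_algebra_add_right)
  qed (simp_all add: mult_monoid_algebra_add_left mult_monoid_algebra_add_right)
qed (simp_all add: mult_monoid_algebra_add_left)

lemma mult_monoid_algebra_one:
  assumes "f \<in> carrier (monoid_algebra G)"
  shows "\<one>\<^bsub>monoid_algebra G\<^esub> \<otimes>\<^bsub>monoid_algebra G\<^esub> f = f"
    and "f \<otimes>\<^bsub>monoid_algebra G\<^esub> \<one>\<^bsub>monoid_algebra G\<^esub> = f"
  using assms
  by (induction f rule: monoid_algebra_induct)
    (simp_all add: mult_monoid_algebra_add_left mult_monoid_algebra_add_right)

lemma complex_algebra_monoid_algebra: "complex_algebra (monoid_algebra G)"
proof -
  have "abelian_group (monoid_algebra G)"
  proof (rule abelian_groupI)
    show "\<exists>y\<in>carrier (monoid_algebra G). y \<oplus>\<^bsub>monoid_algebra G\<^esub> f = \<zero>\<^bsub>monoid_algebra G\<^esub>"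
      if "f \<in> carrier (monoid_algebra G)" for f
      using that by (intro bexI[of _ "Poly_Mapping.map ((*) (- 1)) f"])
        (auto intro!: poly_mapping_eqI dest: keys_map_mult[THEN subsetD] simp: lookup_add)
  qed (auto simp: keys_add_subset algebra_simps dest: Poly_Mapping.keys_add[THEN subsetD])
  moreover have "monoid (monoid_algebra G)"
    by (rule monoidI) (use mult_monoid_algebra_closed mult_monoid_algebra_assoc mult_monoid_algebra_one
        in \<open>simp_all del: monoid_algebra_simps(2)\<close>, simp)
  ultimately have "ring (monoid_algebra G)"
    by (rule ringI) (simp_all add: mult_monoid_algebra_add_left mult_monoid_algebra_add_right)
  moreover have "Poly_Mapping.map ((*) (c + d)) f = Poly_Mapping.map ((*) c) f + Poly_Mapping.map ((*) d) f"
    and "Poly_Mapping.map ((*) c) (Poly_Mapping.map ((*) d) f) = Poly_Mapping.map ((*) (c * d)) f"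
    and "Poly_Mapping.map ((*) 1) f = f"
    for c d and f :: "'a \<Rightarrow>\<^sub>0 complex"
    by (rule poly_mapping_eqI; simp add: lookup_add algebra_simps)+
  moreover have "Poly_Mapping.keys (Poly_Mapping.map ((*) c) f) \<subseteq> carrier G"
    if "Poly_Mapping.keys f \<subseteq> carrier G" for c and f :: "'a \<Rightarrow>\<^sub>0 complex"
    using keys_map_mult that by (rule subset_trans)
  ultimately show ?thesis
    by (intro complex_algebra.intro complex_algebra_axioms.intro)
      (simp_all add: map_mult_add mult_map_mult_left mult_map_mult_right)
qed

text \<open>Lets homomorphisms out of a monoid algebra be compared, and their images be spanned, by
  looking at monoid elements alone.\<close>

lemma carrier_monoid_algebra_eq_lspan:
  "carrier (monoid_algebra G) = lspan (monoid_algebra G) ((\<lambda>a. Poly_Mapping.single a 1) ` carrier G)"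
proof (intro equalityI subsetI)
  fix f assume "f \<in> carrier (monoid_algebra G)"
  then show "f \<in> lspan (monoid_algebra G) ((\<lambda>a. Poly_Mapping.single a 1) ` carrier G)"
  proof (induction f rule: monoid_algebra_induct)
    case zero
    show ?case using lspan.zero[of "monoid_algebra G"] by simp
  next
    case (single a c)
    then show ?case using lspan.base[of "Poly_Mapping.single a 1" _ "monoid_algebra G" c] by simp
  next
    case (add f g)
    then show ?case using lspan.add[of f "monoid_algebra G" _ g] by simp
  qed
next
  interpret MA: complex_algebra "monoid_algebra G" by (rule complex_algebra_monoid_algebra)
  fix f assume "f \<in> lspan (monoid_algebra G) ((\<lambda>a. Poly_Mapping.single a 1) ` carrier G)"
  then show "f \<in> carrier (monoid_algebra G)"
    by (rule MA.lspan_in_carrier[rotated]) auto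
qed

end

section \<open>Universal property of the monoid algebra\<close>

definition algebra_lift ::
    "(complex, 'b) module \<Rightarrow> ('a \<Rightarrow> 'b) \<Rightarrow> ('a \<Rightarrow>\<^sub>0 complex) \<Rightarrow> 'b" where
  "algebra_lift B \<theta> f = (\<Oplus>\<^bsub>B\<^esub>a\<in>Poly_Mapping.keys f. Poly_Mapping.lookup f a \<odot>\<^bsub>B\<^esub> \<theta> a)"

text \<open>The map \<theta> is a homomorphism into the multiplicative monoid of \<open>B\<close>,
  and \<open>algebra_lift B \<theta>\<close> is its linear extension. Used twice: for words in the
  generators with values in the group algebra, and for \<open>G\<close> with values in the presented
  algebra.\<close>

locale monoid_representation = M: monoid M + B: complex_algebra B
  for M :: "('a, 'm) monoid_scheme" (structure) and B :: "(complex, 'b) module" and \<theta> :: "'a \<Rightarrow> 'b" +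
  assumes closed [simp]: "a \<in> carrier M \<Longrightarrow> \<theta> a \<in> carrier B"
    and one: "\<theta> \<one> = \<one>\<^bsub>B\<^esub>"
    and mult: "\<lbrakk>a \<in> carrier M; b \<in> carrier M\<rbrakk> \<Longrightarrow> \<theta> (a \<otimes> b) = \<theta> a \<otimes>\<^bsub>B\<^esub> \<theta> b"
begin

lemma algebra_lift_eq:
  assumes "finite S" "Poly_Mapping.keys f \<subseteq> S" "S \<subseteq> carrier M"
  shows "algebra_lift B \<theta> f = (\<Oplus>\<^bsub>B\<^esub>a\<in>S. Poly_Mapping.lookup f a \<odot>\<^bsub>B\<^esub> \<theta> a)"
  unfolding algebra_lift_def
proof (rule B.add.finprod_mono_neutral_cong_left)
  fix a assume "a \<in> S - Poly_Mapping.keys f"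
  then have "a \<in> carrier M" "Poly_Mapping.lookup f a = 0" using assms(3) by (auto simp: in_keys_iff)
  then show "Poly_Mapping.lookup f a \<odot>\<^bsub>B\<^esub> \<theta> a = \<zero>\<^bsub>B\<^esub>" by simp
qed (use assms in auto)

lemma algebra_lift_closed [simp]:
  "Poly_Mapping.keys f \<subseteq> carrier M \<Longrightarrow> algebra_lift B \<theta> f \<in> carrier B"
  unfolding algebra_lift_def by (intro B.finsum_closed) auto

lemma algebra_lift_single: "a \<in> carrier M \<Longrightarrow> algebra_lift B \<theta> (Poly_Mapping.single a c) = c \<odot>\<^bsub>B\<^esub> \<theta> a"
  by (subst algebra_lift_eq[of "{a}"]) (auto simp: B.add.m_comm)

lemma algebra_lift_add:
  assumes "Poly_Mapping.keys f \<subseteq> carrier M" "Poly_Mapping.keys g \<subseteq> carrier M"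
  shows "algebra_lift B \<theta> (f + g) = algebra_lift B \<theta> f \<oplus>\<^bsub>B\<^esub> algebra_lift B \<theta> g"
proof -
  define S where "S = Poly_Mapping.keys f \<union> Poly_Mapping.keys g"
  have S: "finite S" "S \<subseteq> carrier M" "Poly_Mapping.keys f \<subseteq> S" "Poly_Mapping.keys g \<subseteq> S"
    "Poly_Mapping.keys (f + g) \<subseteq> S"
    using assms Poly_Mapping.keys_add[of f g] by (auto simp: S_def)
  have "algebra_lift B \<theta> (f + g)
      = (\<Oplus>\<^bsub>B\<^esub>a\<in>S. Poly_Mapping.lookup f a \<odot>\<^bsub>B\<^esub> \<theta> a \<oplus>\<^bsub>B\<^esub> Poly_Mapping.lookup g a \<odot>\<^bsub>B\<^esub> \<theta> a)"
    unfolding algebra_lift_eq[OF S(1,5,2)] using S(2)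
    by (intro B.finsum_cong') (auto simp: lookup_add B.smult_add_left)
  also have "\<dots> = algebra_lift B \<theta> f \<oplus>\<^bsub>B\<^esub> algebra_lift B \<theta> g"
    unfolding algebra_lift_eq[OF S(1,3,2)] algebra_lift_eq[OF S(1,4,2)] using S(2)
    by (intro B.finsum_addf) auto
  finally show ?thesis .
qed

lemma algebra_lift_zero [simp]: "algebra_lift B \<theta> 0 = \<zero>\<^bsub>B\<^esub>"
  by (simp add: algebra_lift_def)

lemma algebra_lift_mult:
  assumes "f \<in> carrier (monoid_algebra M)" "g \<in> carrier (monoid_algebra M)"
  shows "algebra_lift B \<theta> (f \<otimes>\<^bsub>monoid_algebra M\<^esub> g) = algebra_lift B \<theta> f \<otimes>\<^bsub>B\<^esub> algebra_lift B \<theta> g"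
  using assms(1)
proof (induction f rule: monoid_algebra_induct)
  case zero
  then show ?case using assms(2) by simp
next
  case (single a c)
  show ?case
    using assms(2)
  proof (induction g rule: monoid_algebra_induct)
    case zero
    then show ?case using single by (simp add: algebra_lift_single)
  next
    case (single b d)
    then show ?case using \<open>a \<in> carrier M\<close>
      by (simp add: algebra_lift_single mult B.mult_smult_left B.mult_smult_right B.smult_smult mult.commute)
  next
    case (add g h)
    moreover from this have "Poly_Mapping.single a c \<otimes>\<^bsub>monoid_algebra M\<^esub> g \<in> carrier (monoid_algebra M)"
      "Poly_Mapping.single a c \<otimes>\<^bsub>monoid_algebra M\<^esub> h \<in> carrier (monoid_algebra M)"
      using single by (auto intro!: M.mult_monoid_algebra_closed simp del: monoid_algebra_simps(1), auto)
    ultimately show ?case using single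
      by (simp add: mult_monoid_algebra_add_right algebra_lift_add B.r_distr algebra_lift_single)
  qed
next
  case (add f h)
  have "f \<otimes>\<^bsub>monoid_algebra M\<^esub> g \<in> carrier (monoid_algebra M)"
    "h \<otimes>\<^bsub>monoid_algebra M\<^esub> g \<in> carrier (monoid_algebra M)"
    using add assms(2) by (blast intro: M.mult_monoid_algebra_closed)+
  then show ?case using add assms(2)
    by (simp add: mult_monoid_algebra_add_left algebra_lift_add B.l_distr)
qed

lemma algebra_lift_smult:
  assumes "f \<in> carrier (monoid_algebra M)"
  shows "algebra_lift B \<theta> (Poly_Mapping.map ((*) c) f) = c \<odot>\<^bsub>B\<^esub> algebra_lift B \<theta> f"
  using assms
proof (induction f rule: monoid_algebra_induct)
  case zero
  have "Poly_Mapping.map ((*) c) 0 = (0 :: 'a \<Rightarrow>\<^sub>0 complex)" by (rule poly_mapping_eqI) simp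
  then show ?case by simp
next
  case (single a d)
  then show ?case by (simp add: algebra_lift_single B.smult_smult)
next
  case (add f g)
  moreover from this have "Poly_Mapping.keys (Poly_Mapping.map ((*) c) f) \<subseteq> carrier M"
    "Poly_Mapping.keys (Poly_Mapping.map ((*) c) g) \<subseteq> carrier M"
    using subset_trans[OF keys_map_mult] by simp_all
  ultimately show ?case by (simp add: map_mult_add algebra_lift_add B.smult_add_right)
qed

lemma algebra_lift_hom: "algebra_lift B \<theta> \<in> algebra_hom (monoid_algebra M) B"
proof (rule algebra_homI, rule ring_hom_memI)
  show "algebra_lift B \<theta> (f \<otimes>\<^bsub>monoid_algebra M\<^esub> g) = algebra_lift B \<theta> f \<otimes>\<^bsub>B\<^esub> algebra_lift B \<theta> g"
    if "f \<in> carrier (monoid_algebra M)" "g \<in> carrier (monoid_algebra M)" for f g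
    using that by (rule algebra_lift_mult)
  show "algebra_lift B \<theta> (c \<odot>\<^bsub>monoid_algebra M\<^esub> f) = c \<odot>\<^bsub>B\<^esub> algebra_lift B \<theta> f"
    if "f \<in> carrier (monoid_algebra M)" for c f
    using algebra_lift_smult[OF that] by simp
qed (auto simp: algebra_lift_add algebra_lift_single one)

end

section \<open>Quotient algebras and presentations\<close>

lemma quotient_algebra_simps:
  "carrier (quotient_algebra A I) = carrier (A Quot I)"
  "monoid.mult (quotient_algebra A I) = monoid.mult (A Quot I)"
  "\<one>\<^bsub>quotient_algebra A I\<^esub> = \<one>\<^bsub>A Quot I\<^esub>"
  "\<zero>\<^bsub>quotient_algebra A I\<^esub> = \<zero>\<^bsub>A Quot I\<^esub>"
  "ring.add (quotient_algebra A I) = ring.add (A Quot I)"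
  by (simp_all add: quotient_algebra_def)

locale algebra_ideal = complex_algebra A + ideal I A
  for A :: "(complex, 'a) module" (structure) and I :: "'a set"
begin

abbreviation Q :: "(complex, 'a set) module" where
  "Q \<equiv> quotient_algebra A I"

lemma carrier_quotient: "carrier Q = (\<lambda>x. I +> x) ` carrier A"
  by (auto simp: quotient_algebra_simps FactRing_simps)

lemma rcos_closed [simp]: "x \<in> carrier A \<Longrightarrow> I +> x \<in> carrier Q"
  by (simp add: carrier_quotient)

lemma mult_rcos: "\<lbrakk>x \<in> carrier A; y \<in> carrier A\<rbrakk> \<Longrightarrow> (I +> x) \<otimes>\<^bsub>Q\<^esub> (I +> y) = I +> x \<otimes> y"
  by (simp add: quotient_algebra_simps FactRing_def rcoset_mult_add)

lemma add_rcos: "\<lbrakk>x \<in> carrier A; y \<in> carrier A\<rbrakk> \<Longrightarrow> (I +> x) \<oplus>\<^bsub>Q\<^esub> (I +> y) = I +> (x \<oplus> y)"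
  by (simp add: quotient_algebra_simps FactRing_def a_rcos_sum)

lemma rcos_eq_iff:
  assumes "x \<in> carrier A" "y \<in> carrier A"
  shows "I +> x = I +> y \<longleftrightarrow> x \<ominus> y \<in> I"
  using quotient_eq_iff_same_a_r_cos[OF ideal_axioms assms] by simp

text \<open>A ring ideal is automatically a linear subspace, because c \<odot> x = (c \<odot>
  \<one>) \<otimes> x.\<close>

lemma smult_ideal: "x \<in> I \<Longrightarrow> c \<odot> x \<in> I"
  using I_l_closed[of x "c \<odot> \<one>"] by (simp add: mult_smult_left)

lemma smult_rcos:
  assumes "x \<in> carrier A"
  shows "c \<odot>\<^bsub>Q\<^esub> (I +> x) = I +> (c \<odot> x)"
proof -
  \<comment> \<open>Scalar multiplication in the quotient is a union over all representatives. They
    all give one coset, since c \<odot> y differs from c \<odot> x by an element of the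
    ideal.\<close>
  have "I +> (c \<odot> y) = I +> (c \<odot> x)" if "y \<in> I +> x" for y
  proof -
    obtain h where h: "h \<in> I" "y = h \<oplus> x"
      using \<open>y \<in> I +> x\<close> by (auto simp: a_r_coset_def')
    then have "c \<odot> y \<in> I +> (c \<odot> x)"
      using assms smult_ideal[OF h(1)] by (auto simp: a_r_coset_def' smult_add_right)
    then show ?thesis
      using a_repr_independence'[of "c \<odot> y" "c \<odot> x"] assms by simp
  qed
  then have "(\<Union>y\<in>I +> x. I +> (c \<odot> y)) = I +> (c \<odot> x)"
    using a_rcos_self[OF assms] by blast
  then show ?thesis by (simp add: quotient_algebra_def)
qed

lemma complex_algebra_quotient: "complex_algebra Q"
proof -
  interpret R: ring "A Quot I" by (rule quotient_is_ring)
  have "ring Q"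
  proof (rule ringI)
    show "abelian_group Q"
      by (rule abelian_groupI)
        (auto simp: quotient_algebra_simps R.a_assoc R.a_comm R.add.m_lcomm intro: bexI[of _ "\<ominus>\<^bsub>A Quot I\<^esub> x" for x] R.l_neg)
    show "monoid Q"
      by (rule monoidI) (auto simp: quotient_algebra_simps R.m_assoc)
  qed (auto simp: quotient_algebra_simps R.l_distr R.r_distr)
  then show ?thesis
    by (intro complex_algebra.intro complex_algebra_axioms.intro)
      (auto simp: carrier_quotient smult_rcos add_rcos mult_rcos smult_add_left smult_add_right
        smult_smult mult_smult_left mult_smult_right)
qed

lemma rcos_hom: "(\<lambda>x. I +> x) \<in> algebra_hom A Q"
proof (rule algebra_homI, rule ring_hom_memI)
  show "I +> \<one> = \<one>\<^bsub>Q\<^esub>" by (simp add: quotient_algebra_simps FactRing_def)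
qed (auto simp: mult_rcos add_rcos smult_rcos)

lemma quotient_lift:
  assumes "complex_algebra C" "\<psi> \<in> algebra_hom A C" "\<And>x. x \<in> I \<Longrightarrow> \<psi> x = \<zero>\<^bsub>C\<^esub>"
  obtains \<chi> where "\<chi> \<in> algebra_hom Q C" "\<And>x. x \<in> carrier A \<Longrightarrow> \<chi> (I +> x) = \<psi> x"
proof -
  interpret C: complex_algebra C by fact
  note \<psi> = algebra_homD[OF assms(2)]
  \<comment> \<open>The choice of representative does not matter: two of them differ by an element
    of \<open>I\<close>, which \<psi> sends to zero.\<close>
  define \<chi> where "\<chi> Y = \<psi> (SOME y. y \<in> Y)" for Y
  have \<chi>: "\<chi> (I +> x) = \<psi> x" if "x \<in> carrier A" for x
  proof -
    have "(SOME y. y \<in> I +> x) \<in> I +> x"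
      using a_rcos_self[OF that] by (rule someI)
    then obtain h where "h \<in> I" "(SOME y. y \<in> I +> x) = h \<oplus> x"
      by (auto simp: a_r_coset_def')
    then show ?thesis
      using that assms(3) ring_hom_add[OF \<psi>(1)] ring_hom_closed[OF \<psi>(1)] by (simp add: \<chi>_def)
  qed
  have "\<chi> \<in> algebra_hom Q C"
  proof (rule algebra_homI, rule ring_hom_memI)
    show "\<chi> \<one>\<^bsub>Q\<^esub> = \<one>\<^bsub>C\<^esub>"
      using \<chi>[of \<one>] ring_hom_one[OF \<psi>(1)] by (simp add: quotient_algebra_simps FactRing_def)
  qed (auto simp: carrier_quotient mult_rcos add_rcos smult_rcos \<chi> \<psi>(2) ring_hom_mult[OF \<psi>(1)]
      ring_hom_add[OF \<psi>(1)] ring_hom_closed[OF \<psi>(1)])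
  with \<chi> show thesis by (rule that[rotated])
qed

end

section \<open>Free algebras and presentations\<close>

lemma monoid_free_monoid: "monoid (free_monoid X)"
  by (rule monoidI) (auto simp: free_monoid_def)

lemma complex_algebra_free_algebra: "complex_algebra (free_algebra X)"
  unfolding free_algebra_def by (intro monoid.complex_algebra_monoid_algebra monoid_free_monoid)

lemma free_algebra_simps:
  "\<one>\<^bsub>free_algebra X\<^esub> = Poly_Mapping.single [] 1"
  "Poly_Mapping.single u c \<otimes>\<^bsub>free_algebra X\<^esub> Poly_Mapping.single v d = Poly_Mapping.single (u @ v) (c * d)"
  by (simp_all add: free_algebra_def) (simp_all add: free_monoid_def)

lemma free_gen_closed: "x \<in> X \<Longrightarrow> free_gen x \<in> carrier (free_algebra X)"
  by (simp add: free_gen_def free_algebra_def free_monoid_def)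

lemma carrier_free_algebra:
  "carrier (free_algebra X) = lspan (free_algebra X) ((\<lambda>u. Poly_Mapping.single u 1) ` {u. set u \<subseteq> X})"
  using monoid.carrier_monoid_algebra_eq_lspan[OF monoid_free_monoid, of X]
  by (simp add: free_algebra_def free_monoid_def)

text \<open>Both sides of a relation must lie in the free algebra, so that their differences
  generate a genuine ideal there.\<close>

locale presentation =
  fixes X :: "'a set" and S :: "(('a list \<Rightarrow>\<^sub>0 complex) \<times> ('a list \<Rightarrow>\<^sub>0 complex)) set"
  assumes relations_closed:
    "(l, r) \<in> S \<Longrightarrow> l \<in> carrier (free_algebra X) \<and> r \<in> carrier (free_algebra X)"
begin

sublocale F: complex_algebra "free_algebra X"
  by (rule complex_algebra_free_algebra)

lemma relators_closed:
  "{l \<ominus>\<^bsub>free_algebra X\<^esub> r | l r. (l, r) \<in> S} \<subseteq> carrier (free_algebra X)"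
proof
  fix x assume "x \<in> {l \<ominus>\<^bsub>free_algebra X\<^esub> r | l r. (l, r) \<in> S}"
  then obtain l r where "x = l \<ominus>\<^bsub>free_algebra X\<^esub> r" "(l, r) \<in> S" by blast
  then show "x \<in> carrier (free_algebra X)" using relations_closed[of l r] by simp
qed

sublocale algebra_ideal "free_algebra X" "relation_ideal X S"
  unfolding relation_ideal_def
  by (intro algebra_ideal.intro complex_algebra_free_algebra F.genideal_ideal relators_closed)

definition proj :: "('a list \<Rightarrow>\<^sub>0 complex) \<Rightarrow> ('a list \<Rightarrow>\<^sub>0 complex) set" where
  "proj x = relation_ideal X S +>\<^bsub>free_algebra X\<^esub> x"

lemma complex_algebra_presented: "complex_algebra (presented_algebra X S)"
  unfolding presented_algebra_def by (rule complex_algebra_quotient)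

lemma proj_hom: "proj \<in> algebra_hom (free_algebra X) (presented_algebra X S)"
  using rcos_hom by (simp add: presented_algebra_def proj_def[abs_def])

lemma carrier_presented: "carrier (presented_algebra X S) = proj ` carrier (free_algebra X)"
  using carrier_quotient by (simp add: presented_algebra_def proj_def[abs_def])

lemma proj_relation:
  assumes "(l, r) \<in> S"
  shows "proj l = proj r"
proof -
  have "l \<ominus>\<^bsub>free_algebra X\<^esub> r \<in> relation_ideal X S"
    using F.genideal_self[OF relators_closed] assms by (auto simp: relation_ideal_def)
  then show ?thesis
    using rcos_eq_iff relations_closed[OF assms] by (simp add: proj_def)
qed

text \<open>The kernel of \<psi> is an ideal containing the difference of the two sides of each
  relation, hence the ideal generated by these differences, so \<psi> factors through the
  quotient.\<close>

lemma presented_lift: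
  assumes "complex_algebra C" "\<psi> \<in> algebra_hom (free_algebra X) C"
    and "\<And>l r. (l, r) \<in> S \<Longrightarrow> \<psi> l = \<psi> r"
  obtains \<chi> where "\<chi> \<in> algebra_hom (presented_algebra X S) C"
    "\<And>x. x \<in> carrier (free_algebra X) \<Longrightarrow> \<chi> (proj x) = \<psi> x"
proof -
  interpret C: complex_algebra C by fact
  interpret \<psi>: ring_hom_ring "free_algebra X" C \<psi>
    by (intro ring_hom_ringI2 F.ring_axioms C.ring_axioms algebra_homD(1)[OF assms(2)])
  have "\<psi> (l \<ominus>\<^bsub>free_algebra X\<^esub> r) = \<zero>\<^bsub>C\<^esub>" if "(l, r) \<in> S" for l r
    using relations_closed[OF that] assms(3)[OF that]
    by (simp add: a_minus_def C.r_neg)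
  then have "{l \<ominus>\<^bsub>free_algebra X\<^esub> r | l r. (l, r) \<in> S} \<subseteq> a_kernel (free_algebra X) C \<psi>"
    using subsetD[OF relators_closed] unfolding a_kernel_def' by blast
  then have "relation_ideal X S \<subseteq> a_kernel (free_algebra X) C \<psi>"
    unfolding relation_ideal_def by (rule F.genideal_minimal[OF \<psi>.kernel_is_ideal])
  then have "\<psi> x = \<zero>\<^bsub>C\<^esub>" if "x \<in> relation_ideal X S" for x
    using that unfolding a_kernel_def' by blast
  from quotient_lift[OF assms(1,2) this] obtain \<chi> where
    "\<chi> \<in> algebra_hom Q C" "\<And>x. x \<in> carrier (free_algebra X) \<Longrightarrow> \<chi> (proj x) = \<psi> x"
    unfolding proj_def by blast
  then show thesis unfolding presented_algebra_def[symmetric] by (rule that)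
qed

end

section \<open>Reduction of words\<close>

text \<open>Isolates what the word reduction uses. \<open>U\<close> stands for the images of the
  group elements, and \<open>e_conj\<close> moves them to the left at the price of changing an
  index. In \<open>e_commute_or_contract\<close> a vanishing product counts as a contraction with
  coefficient zero.\<close>

locale contracting_generators = complex_algebra A
  for A :: "(complex, 'a) module" (structure) +
  fixes U :: "'a set" and P :: "'p set" and e :: "'p \<Rightarrow> 'a"
  assumes U_closed: "U \<subseteq> carrier A"
    and one_in_U: "\<one> \<in> U"
    and U_mult: "\<lbrakk>u \<in> U; v \<in> U\<rbrakk> \<Longrightarrow> u \<otimes> v \<in> U"
    and e_closed [simp]: "i \<in> P \<Longrightarrow> e i \<in> carrier A"
    and e_conj: "\<lbrakk>i \<in> P; u \<in> U\<rbrakk> \<Longrightarrow> \<exists>j\<in>P. e i \<otimes> u = u \<otimes> e j"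
    and e_square: "i \<in> P \<Longrightarrow> \<exists>c. e i \<otimes> e i = c \<odot> e i"
    and e_commute_or_contract: "\<lbrakk>i \<in> P; j \<in> P; i \<noteq> j\<rbrakk> \<Longrightarrow>
      e i \<otimes> e j = e j \<otimes> e i \<or> (\<exists>x\<in>lspan A U. e i \<otimes> e j = x \<otimes> e j)"
begin

definition eword :: "'p list \<Rightarrow> 'a" where
  "eword xs = foldr (\<lambda>i v. e i \<otimes> v) xs \<one>"

lemma eword_simps [simp]: "eword [] = \<one>" "eword (i # xs) = e i \<otimes> eword xs"
  by (simp_all add: eword_def)

lemma eword_closed [simp]: "set xs \<subseteq> P \<Longrightarrow> eword xs \<in> carrier A"
  by (induction xs) auto

lemma U_in_carrier [simp]: "u \<in> U \<Longrightarrow> u \<in> carrier A"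
  using U_closed by blast

text \<open>The predicate is left open because two conditions occur: a length bound during the
  reduction, and distinct letters in the final spanning set.\<close>

definition words :: "('p list \<Rightarrow> bool) \<Rightarrow> 'a set" where
  "words Q = {u \<otimes> eword xs | u xs. u \<in> U \<and> set xs \<subseteq> P \<and> Q xs}"

lemma wordsI: "\<lbrakk>u \<in> U; set xs \<subseteq> P; Q xs\<rbrakk> \<Longrightarrow> u \<otimes> eword xs \<in> words Q"
  by (auto simp: words_def)

lemma words_closed: "words Q \<subseteq> carrier A"
  by (auto simp: words_def)

abbreviation short :: "nat \<Rightarrow> 'a set" where
  "short n \<equiv> lspan A (words (\<lambda>xs. length xs < n))"

text \<open>The new factor merges with the group element in front and leaves the letters alone, so
  every condition on the letters survives.\<close>

lemma U_mult_lspan_words: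
  assumes "u \<in> U" "v \<in> lspan A (words Q)"
  shows "u \<otimes> v \<in> lspan A (words Q)"
proof (rule lspan_mult_left[OF words_closed words_closed _ _ assms(2)])
  fix x assume "x \<in> words Q"
  then obtain u' xs where x: "x = u' \<otimes> eword xs" "u' \<in> U" "set xs \<subseteq> P" "Q xs"
    by (auto simp: words_def)
  then have "u \<otimes> x = (u \<otimes> u') \<otimes> eword xs" using assms(1) by (simp add: m_assoc)
  then have "u \<otimes> x \<in> words Q"
    using wordsI[of "u \<otimes> u'" xs Q] x assms(1) U_mult by simp
  then show "u \<otimes> x \<in> lspan A (words Q)" by (rule lspan_superset[OF words_closed])
qed (use assms(1) in simp)

text \<open>On its way past the group element in front, \<open>e i\<close> turns into
  \<open>e j\<close> for an index j that is not controlled. This is why the hypothesis on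
  \<open>R\<close> ranges over all j in \<open>P\<close>.\<close>

lemma e_mult_lspan_words:
  assumes "i \<in> P" "v \<in> lspan A (words Q)"
    and R: "\<And>j xs. \<lbrakk>j \<in> P; set xs \<subseteq> P; Q xs\<rbrakk> \<Longrightarrow> eword (j # xs) \<in> lspan A (words R)"
  shows "e i \<otimes> v \<in> lspan A (words R)"
proof (rule lspan_mult_left[OF words_closed words_closed _ _ assms(2)])
  fix x assume "x \<in> words Q"
  then obtain u xs where x: "x = u \<otimes> eword xs" "u \<in> U" "set xs \<subseteq> P" "Q xs"
    by (auto simp: words_def)
  obtain j where j: "j \<in> P" "e i \<otimes> u = u \<otimes> e j" using e_conj[OF assms(1) x(2)] by blast
  have "e i \<otimes> x = (e i \<otimes> u) \<otimes> eword xs" using x assms(1) by (simp add: m_assoc)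
  also have "\<dots> = u \<otimes> eword (j # xs)" using x j by (simp add: m_assoc)
  also have "\<dots> \<in> lspan A (words R)"
    using U_mult_lspan_words[OF x(2)] R[OF j(1) x(3,4)] by blast
  finally show "e i \<otimes> x \<in> lspan A (words R)" .
qed (use assms(1) in simp)

lemma eword_in_lspan_words:
  assumes "set xs \<subseteq> P" "Q xs"
  shows "eword xs \<in> lspan A (words Q)"
proof (rule lspan_superset[OF words_closed])
  show "eword xs \<in> words Q"
    using wordsI[of \<one> xs Q] one_in_U assms by simp
qed

lemma e_mult_short:
  assumes "i \<in> P" "v \<in> short n"
  shows "e i \<otimes> v \<in> short (Suc n)"
  using assms by (rule e_mult_lspan_words) (rule eword_in_lspan_words, auto)

text \<open>The bound is strict: \<open>i # xs\<close> has length \<open>Suc (length xs)\<close>, so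
  at least one letter is saved. The induction strips off the letters that \<open>i\<close> crosses
  on its way to its other occurrence.\<close>

lemma eword_Cons_in_short:
  assumes "set xs \<subseteq> P" "i \<in> set xs"
  shows "eword (i # xs) \<in> short (Suc (length xs))"
  using assms
proof (induction xs)
  case (Cons j xs)
  then have ij: "i \<in> P" "j \<in> P" and xs: "set xs \<subseteq> P" by auto
  \<comment> \<open>This is the word without its first letter. The squaring case and the contracting
    case both end here, up to a coefficient on the left.\<close>
  have tail: "eword (j # xs) \<in> short (Suc (length (j # xs)))"
    using ij xs by (intro eword_in_lspan_words) auto
  have split: "eword (i # j # xs) = (e i \<otimes> e j) \<otimes> eword xs"
    using ij xs by (simp add: m_assoc)
  show ?case
  proof (cases "i = j")
    case True
    then obtain c where "e i \<otimes> e j = c \<odot> e j" using e_square[OF ij(2)] by auto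
    then have "eword (i # j # xs) = c \<odot> eword (j # xs)"
      using split ij xs by (simp add: mult_smult_left)
    then show ?thesis using lspan_smult[OF words_closed tail] by simp
  next
    case False
    \<comment> \<open>Since i \<noteq> j, the other occurrence of \<open>i\<close> lies in
      \<open>xs\<close>, so the induction hypothesis applies with \<open>j\<close> left out.\<close>
    then have IH: "eword (i # xs) \<in> short (Suc (length xs))" using Cons xs by auto
    consider "e i \<otimes> e j = e j \<otimes> e i" | x where "x \<in> lspan A U" "e i \<otimes> e j = x \<otimes> e j"
      using e_commute_or_contract[OF ij False] by blast
    then show ?thesis
    proof cases
      case 1
      \<comment> \<open>Putting \<open>e j\<close> back in front of words already shortened costs
        one letter, exactly the amount by which the bound has grown.\<close>
      then have "eword (i # j # xs) = e j \<otimes> eword (i # xs)"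
        using split ij xs by (simp add: m_assoc)
      then show ?thesis using e_mult_short[OF ij(2) IH] by simp
    next
      case 2
      have "x \<otimes> eword (j # xs) \<in> short (Suc (length (j # xs)))"
      proof (rule lspan_mult_right[OF U_closed words_closed _ _ 2(1)])
        show "eword (j # xs) \<in> carrier A" using ij xs by (intro eword_closed) simp
      qed (rule U_mult_lspan_words[OF _ tail])
      moreover have "x \<in> carrier A" using lspan_in_carrier[OF U_closed 2(1)] .
      ultimately show ?thesis using split 2(2) ij xs by (simp add: m_assoc)
    qed
  qed
qed simp

text \<open>Either the head recurs in the tail, or the tail has a repetition itself; in the second
  case the tail is shortened and the head is put back.\<close>

lemma eword_not_distinct:
  assumes "set xs \<subseteq> P" "\<not> distinct xs"
  shows "eword xs \<in> short (length xs)"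
  using assms
proof (induction xs)
  case (Cons i xs)
  then show ?case
    using eword_Cons_in_short[of xs i] e_mult_short[of i "eword xs" "length xs"] by auto
qed simp

lemma eword_in_lspan_distinct:
  assumes "set xs \<subseteq> P"
  shows "eword xs \<in> lspan A (words distinct)"
  using assms
proof (induction xs rule: length_induct)
  case (1 xs)
  show ?case
  proof (cases "distinct xs")
    case True
    then show ?thesis using 1 by (simp add: eword_in_lspan_words)
  next
    case False
    \<comment> \<open>The shorter words may still contain repetitions, so the induction hypothesis
      is applied to them; the group elements in front are absorbed.\<close>
    have "words (\<lambda>ys. length ys < length xs) \<subseteq> lspan A (words distinct)"
      using 1 by (auto simp: words_def[of "\<lambda>ys. length ys < length xs"] intro!: U_mult_lspan_words)
    then have "short (length xs) \<subseteq> lspan A (words distinct)"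
      by (rule lspan_minimal[OF words_closed])
    then show ?thesis using eword_not_distinct[OF _ False] 1 by blast
  qed
qed

lemma e_mult_lspan_distinct:
  assumes "i \<in> P" "v \<in> lspan A (words distinct)"
  shows "e i \<otimes> v \<in> lspan A (words distinct)"
  using assms by (rule e_mult_lspan_words) (rule eword_in_lspan_distinct, auto)

lemma finite_words_distinct:
  assumes "finite U" "finite P"
  shows "finite (words distinct)"
proof -
  have "words distinct = (\<lambda>(u, xs). u \<otimes> eword xs) ` (U \<times> {xs. set xs \<subseteq> P \<and> distinct xs})"
    by (auto simp: words_def)
  then show ?thesis using assms by (simp add: finite_subset_distinct)
qed

end

section \<open>Pseudo reflection groups\<close>

lemma GL_simps [simp]:
  "carrier (GL scale) = {f. Vector_Spaces.linear scale scale f \<and> bij f}"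
  "f \<otimes>\<^bsub>GL scale\<^esub> g = f \<circ> g"
  "\<one>\<^bsub>GL scale\<^esub> = id"
  by (simp_all add: GL_def)

text \<open>The conjugate fixes the image of \<open>U\<close> under \<open>w\<close> pointwise,
  which has the dimension of \<open>U\<close> because \<open>w\<close> is injective. Its powers are
  the conjugates of the powers of \<open>s\<close>, so its order stays finite.\<close>

lemma pseudo_reflection_conj:
  fixes w w' s :: "'v::ab_group_add \<Rightarrow> 'v"
  assumes "finite_dimensional_space scale" "w \<in> carrier (GL scale)" "w' \<in> carrier (GL scale)"
    and inv: "w' \<circ> w = id" "w \<circ> w' = id" and s: "pseudo_reflection scale s"
  shows "pseudo_reflection scale (w \<circ> s \<circ> w')"
proof -
  obtain Basis where "finite_dimensional_vector_space scale Basis"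
    using assms(1) by (auto simp: finite_dimensional_space_def)
  then interpret V: finite_dimensional_vector_space scale Basis .
  interpret VV: finite_dimensional_vector_space_pair scale Basis scale Basis
    by unfold_locales
  have lin: "Vector_Spaces.linear scale scale w" "Vector_Spaces.linear scale scale s"
    "Vector_Spaces.linear scale scale w'" and bij: "bij w" "bij s" "bij w'"
    using assms(2,3) s by (auto simp: pseudo_reflection_def)
  interpret w: Vector_Spaces.linear scale scale w by fact
  have w'w: "w' (w v) = v" and ww': "w (w' v) = v" for v
    using inv by (simp_all add: fun_eq_iff)
  obtain n U where n: "n > 0" "s ^^ n = id" and U: "V.subspace U" "Suc (V.dim U) = V.dim UNIV"
    "\<And>v. v \<in> U \<Longrightarrow> s v = v"
    using s by (auto simp: pseudo_reflection_def)
  have "(w \<circ> s \<circ> w') ^^ k = w \<circ> s ^^ k \<circ> w'" for k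
    by (induction k) (simp_all add: fun_eq_iff w'w ww')
  then have "(w \<circ> s \<circ> w') ^^ n = id" using n(2) inv(2) by simp
  moreover have "w \<circ> s \<circ> w' \<noteq> id"
  proof
    assume "w \<circ> s \<circ> w' = id"
    then have "s v = v" for v
      using w'w by (metis comp_apply id_apply)
    then show False using s by (auto simp: pseudo_reflection_def)
  qed
  moreover have "w \<circ> s \<circ> w' \<in> carrier (GL scale)"
    using lin bij by (auto intro!: Vector_Spaces.linear_compose bij_comp)
  moreover have "V.subspace (w ` U)"
    using U(1) by (rule w.subspace_image)
  moreover have "V.dim (w ` U) = V.dim U"
    using bij(1) by (intro VV.dim_image_eq lin) (meson bij_is_inj inj_on_subset subset_UNIV)
  ultimately show ?thesis
    unfolding pseudo_reflection_def using n(1) U w'w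
    by (intro conjI exI[of _ n] exI[of _ "w ` U"]) auto
qed

locale reflection_setting =
  fixes scale :: "complex \<Rightarrow> 'v::ab_group_add \<Rightarrow> 'v"
    and G :: "('v \<Rightarrow> 'v) set"
    and P :: "'p set"
    and H :: "'p \<Rightarrow> 'v set"
    and \<mu> :: "('v \<Rightarrow> 'v) \<Rightarrow> complex"
    and m :: "'p \<Rightarrow> complex"
  assumes reflection_group: "finite_pseudo_reflection_group scale G"
    and hyperplanes: "bij_betw H P (reflection_hyperplanes scale G)"
begin

lemma finite_G: "finite G"
  using reflection_group by (simp add: finite_pseudo_reflection_group_def)

lemma subgroup_G: "subgroup G (GL scale)"
  using reflection_group by (simp add: finite_pseudo_reflection_group_def)

lemma G_subset: "G \<subseteq> carrier (GL scale)"
  by (rule subgroup.subset[OF subgroup_G])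

lemma id_in_G: "id \<in> G"
  using subgroup.one_closed[OF subgroup_G] by simp

lemma comp_in_G: "\<lbrakk>g \<in> G; h \<in> G\<rbrakk> \<Longrightarrow> g \<circ> h \<in> G"
  using subgroup.m_closed[OF subgroup_G] by simp

text \<open>Left translation by \<open>w\<close> is injective on the finite set \<open>G\<close>,
  hence onto. The element sent to \<open>id\<close> is a right inverse, and injectivity of
  \<open>w\<close> makes it two-sided.\<close>

lemma inverse_in_G:
  assumes "w \<in> G"
  obtains w' where "w' \<in> G" "w' \<circ> w = id" "w \<circ> w' = id"
proof -
  have "bij w" using assms G_subset by auto
  then have "inj_on ((\<circ>) w) G"
    by (auto intro!: inj_onI dest: bij_is_inj simp: inj_eq fun_eq_iff)
  moreover have "(\<circ>) w ` G \<subseteq> G" using assms comp_in_G by auto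
  ultimately have "(\<circ>) w ` G = G" using finite_G by (intro endo_inj_surj)
  with id_in_G obtain w' where w': "w' \<in> G" "w \<circ> w' = id" by (metis imageE)
  then have "w (w' (w v)) = w v" for v by (simp add: fun_eq_iff)
  then have "w' \<circ> w = id" using \<open>bij w\<close> by (simp add: fun_eq_iff bij_is_inj inj_eq)
  with w' show thesis by (intro that)
qed

lemma finite_P: "finite P"
  using bij_betw_finite[OF hyperplanes] finite_G
  by (simp add: reflection_hyperplanes_def pseudo_reflections_def)

text \<open>\<open>H i\<close> is the fixed space of a reflection s in \<open>G\<close>. Conjugating
  s by the inverse of \<open>w\<close> gives a reflection whose fixed space is carried onto
  \<open>H i\<close> by \<open>w\<close>. This provides the index required by
  \<open>e_conj\<close>.\<close>

lemma hyperplane_preimage: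
  assumes "i \<in> P" "w \<in> G"
  obtains j where "j \<in> P" "w ` H j = H i"
proof -
  obtain w' where w': "w' \<in> G" "w' \<circ> w = id" "w \<circ> w' = id" using assms(2) by (rule inverse_in_G)
  then have inv: "w' (w v) = v" "w (w' v) = v" for v by (simp_all add: fun_eq_iff)
  have "H i \<in> fixed_space ` pseudo_reflections scale G"
    using bij_betw_apply[OF hyperplanes assms(1)] by (simp add: reflection_hyperplanes_def)
  then obtain s where s: "s \<in> G" "pseudo_reflection scale s" "H i = fixed_space s"
    by (auto simp: pseudo_reflections_def)
  have "pseudo_reflection scale (w' \<circ> s \<circ> w)"
    using reflection_group G_subset assms(2) w' s(2)
    by (intro pseudo_reflection_conj) (auto simp: finite_pseudo_reflection_group_def)
  then have "fixed_space (w' \<circ> s \<circ> w) \<in> reflection_hyperplanes scale G"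
    using w'(1) s(1) assms(2)
    by (auto simp: reflection_hyperplanes_def pseudo_reflections_def intro!: comp_in_G)
  then obtain j where "j \<in> P" "H j = fixed_space (w' \<circ> s \<circ> w)"
    using hyperplanes unfolding bij_betw_def by (metis imageE)
  moreover have "w ` fixed_space (w' \<circ> s \<circ> w) = fixed_space s"
  proof (intro equalityI subsetI)
    fix v assume "v \<in> w ` fixed_space (w' \<circ> s \<circ> w)"
    then show "v \<in> fixed_space s" by (auto simp: fixed_space_def) (metis inv(2))
  next
    fix v assume "v \<in> fixed_space s"
    then have "w' v \<in> fixed_space (w' \<circ> s \<circ> w)" by (simp add: fixed_space_def inv)
    then show "v \<in> w ` fixed_space (w' \<circ> s \<circ> w)" using inv(2) by (metis imageI)
  qed
  ultimately show thesis using s(3) that by simp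
qed

section \<open>The algebra \<open>B\<^sub>G(\<Upsilon>)\<close>\<close>

abbreviation X :: "('v \<Rightarrow> 'v, 'p) generator set" where
  "X \<equiv> generators G P"

abbreviation F :: "(complex, ('v \<Rightarrow> 'v, 'p) generator list \<Rightarrow>\<^sub>0 complex) module" where
  "F \<equiv> free_algebra X"

abbreviation S ::
    "((('v \<Rightarrow> 'v, 'p) generator list \<Rightarrow>\<^sub>0 complex) \<times> (('v \<Rightarrow> 'v, 'p) generator list \<Rightarrow>\<^sub>0 complex)) set" where
  "S \<equiv> B_relations scale G P H \<mu> m"

abbreviation B :: "(complex, (('v \<Rightarrow> 'v, 'p) generator list \<Rightarrow>\<^sub>0 complex) set) module" where
  "B \<equiv> B_algebra scale G P H \<mu> m"

abbreviation C :: "(complex, ('v \<Rightarrow> 'v) \<Rightarrow>\<^sub>0 complex) module" where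
  "C \<equiv> group_algebra scale G"

lemma w_gen_closed [simp]: "w \<in> G \<Longrightarrow> w_gen w \<in> carrier F"
  and e_gen_closed [simp]: "i \<in> P \<Longrightarrow> e_gen i \<in> carrier F"
  by (auto intro: free_gen_closed simp: generators_def)

lemma reflections_between_subset: "reflections_between scale G H i j \<subseteq> G"
  by (auto simp: reflections_between_def pseudo_reflections_def)

text \<open>Once projected to the quotient, this is the coefficient that
  \<open>e_commute_or_contract\<close> asks for.\<close>

lemma contraction_in_lspan:
  "(\<Oplus>\<^bsub>F\<^esub>s\<in>reflections_between scale G H i j. \<mu> s \<odot>\<^bsub>F\<^esub> w_gen s) \<in> lspan F (w_gen ` G)"
proof -
  interpret F: complex_algebra F by (rule complex_algebra_free_algebra)
  show ?thesis
  proof (rule F.lspan_finsum)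
    fix s assume "s \<in> reflections_between scale G H i j"
    then have "s \<in> G" using reflections_between_subset by blast
    then show "\<mu> s \<odot>\<^bsub>F\<^esub> w_gen s \<in> lspan F (w_gen ` G)" by (intro lspan.base imageI)
  qed auto
qed

lemma contraction_closed [simp]:
  "(\<Oplus>\<^bsub>F\<^esub>s\<in>reflections_between scale G H i j. \<mu> s \<odot>\<^bsub>F\<^esub> w_gen s) \<in> carrier F"
proof -
  interpret F: complex_algebra F by (rule complex_algebra_free_algebra)
  show ?thesis
    by (rule F.lspan_in_carrier[OF _ contraction_in_lspan]) auto
qed

sublocale presentation X S
proof
  interpret F: complex_algebra F by (rule complex_algebra_free_algebra)
  fix l r assume "(l, r) \<in> S"
  then show "l \<in> carrier F \<and> r \<in> carrier F"
    by cases (auto simp: id_in_G comp_in_G pseudo_reflections_def)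
qed

lemma B_eq: "B = presented_algebra X S"
  by (simp add: B_algebra_def)

lemma proj_gens: "proj (w_gen w) = B_bar scale G P H \<mu> m w"
  by (simp add: proj_def B_bar_def presented_gen_def)

lemma complex_algebra_B: "complex_algebra B"
  unfolding B_eq by (rule complex_algebra_presented)

sublocale B: complex_algebra B
  by (rule complex_algebra_B)

lemmas proj_alg_hom = proj_hom[folded B_eq]
lemmas proj_ring_hom = algebra_homD(1)[OF proj_alg_hom]

lemma proj_closed [simp]: "x \<in> carrier F \<Longrightarrow> proj x \<in> carrier B"
  using ring_hom_closed[OF proj_ring_hom] .

lemma proj_mult:
  "\<lbrakk>x \<in> carrier F; y \<in> carrier F\<rbrakk> \<Longrightarrow> proj (x \<otimes>\<^bsub>F\<^esub> y) = proj x \<otimes>\<^bsub>B\<^esub> proj y"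
  using ring_hom_mult[OF proj_ring_hom] .

lemma proj_w_mult:
  assumes "w1 \<in> G" "w2 \<in> G"
  shows "proj (w_gen w1) \<otimes>\<^bsub>B\<^esub> proj (w_gen w2) = proj (w_gen (w1 \<circ> w2))"
  using proj_relation[OF B_relations.group_mult[OF assms]] assms by (simp add: proj_mult)

lemma proj_w_id: "proj (w_gen id) = \<one>\<^bsub>B\<^esub>"
  using proj_relation[OF B_relations.group_one] ring_hom_one[OF proj_ring_hom] by simp

text \<open>The requirements on products with the \<open>e i\<close> are defining relations read in
  the quotient. Only \<open>e_conj\<close> also needs geometry, namely that some hyperplane of the
  family is carried to \<open>H i\<close>.\<close>

sublocale contracting_generators B "(\<lambda>w. proj (w_gen w)) ` G" P "\<lambda>i. proj (e_gen i)"
proof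
  show "(\<lambda>w. proj (w_gen w)) ` G \<subseteq> carrier B" by auto
  show "\<one>\<^bsub>B\<^esub> \<in> (\<lambda>w. proj (w_gen w)) ` G" using proj_w_id id_in_G by (metis imageI)
  show "u \<otimes>\<^bsub>B\<^esub> v \<in> (\<lambda>w. proj (w_gen w)) ` G"
    if "u \<in> (\<lambda>w. proj (w_gen w)) ` G" "v \<in> (\<lambda>w. proj (w_gen w)) ` G" for u v
    using that by (auto simp: proj_w_mult comp_in_G)
  fix i assume i: "i \<in> P"
  then show "proj (e_gen i) \<in> carrier B" by simp
  show "\<exists>j\<in>P. proj (e_gen i) \<otimes>\<^bsub>B\<^esub> u = u \<otimes>\<^bsub>B\<^esub> proj (e_gen j)"
    if u: "u \<in> (\<lambda>w. proj (w_gen w)) ` G" for u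
  proof -
    obtain w where w: "w \<in> G" "u = proj (w_gen w)" using u by auto
    obtain j where j: "j \<in> P" "w ` H j = H i" using hyperplane_preimage[OF i w(1)] .
    from proj_relation[OF B_relations.conjugate[OF i j(1) w(1) j(2)]] show ?thesis
      using i j(1) w by (auto simp: proj_mult intro!: bexI[of _ j])
  qed
  show "\<exists>c. proj (e_gen i) \<otimes>\<^bsub>B\<^esub> proj (e_gen i) = c \<odot>\<^bsub>B\<^esub> proj (e_gen i)"
    using proj_relation[OF B_relations.square[OF i]] i algebra_homD(2)[OF proj_alg_hom e_gen_closed]
    by (auto simp: proj_mult)
  fix j assume j: "j \<in> P" and ij: "i \<noteq> j"
  show "proj (e_gen i) \<otimes>\<^bsub>B\<^esub> proj (e_gen j) = proj (e_gen j) \<otimes>\<^bsub>B\<^esub> proj (e_gen i)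
      \<or> (\<exists>x\<in>lspan B ((\<lambda>w. proj (w_gen w)) ` G).
          proj (e_gen i) \<otimes>\<^bsub>B\<^esub> proj (e_gen j) = x \<otimes>\<^bsub>B\<^esub> proj (e_gen j))"
  proof (cases "hyperplanes_above P H i j = {i, j}")
    case True
    from proj_relation[OF B_relations.commute[OF i j ij True]] show ?thesis
      using i j by (simp add: proj_mult)
  next
    case above: False
    show ?thesis
    proof (cases "reflections_between scale G H i j = {}")
      case True
      from proj_relation[OF B_relations.annihilate[OF i j ij above True]]
      \<comment> \<open>The vanishing product is put in the form of a contraction; its coefficient
        zero lies in every span.\<close>
      have "proj (e_gen i) \<otimes>\<^bsub>B\<^esub> proj (e_gen j) = \<zero>\<^bsub>B\<^esub> \<otimes>\<^bsub>B\<^esub> proj (e_gen j)"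
        using i j ring_hom_zero[OF proj_ring_hom F.ring_axioms B.ring_axioms] by (simp add: proj_mult)
      then show ?thesis using lspan.zero by blast
    next
      case False
      have "w_gen ` G \<subseteq> carrier F" by auto
      from algebra_hom_image_lspan[OF F.complex_algebra_axioms complex_algebra_B proj_alg_hom this
          contraction_in_lspan[of i j]]
        proj_relation[OF B_relations.contract[OF i j ij above False]]
      show ?thesis
        using i j by (auto simp: proj_mult image_image)
    qed
  qed
qed

text \<open>The span of the reduced words contains the unit and is stable under left multiplication
  by every generator, so it absorbs a word letter by letter, starting from the right end.\<close>

lemma proj_word_in_lspan:
  assumes "set u \<subseteq> X"
  shows "proj (Poly_Mapping.single u 1) \<in> lspan B (words distinct)"
  using assms
proof (induction u)
  case Nil
  have "proj (Poly_Mapping.single [] 1) = \<one>\<^bsub>B\<^esub>"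
    using ring_hom_one[OF proj_ring_hom] by (simp add: free_algebra_simps)
  then show ?case using eword_in_lspan_distinct[of "[]"] by simp
next
  case (Cons x u)
  have x: "free_gen x \<in> carrier F" using Cons.prems by (simp add: free_gen_closed)
  have u: "Poly_Mapping.single u 1 \<in> carrier F"
    using Cons.prems by (simp add: free_algebra_def free_monoid_def)
  have split: "proj (Poly_Mapping.single (x # u) 1) = proj (free_gen x) \<otimes>\<^bsub>B\<^esub> proj (Poly_Mapping.single u 1)"
    using proj_mult[OF x u] by (simp add: free_gen_def free_algebra_simps)
  have IH: "proj (Poly_Mapping.single u 1) \<in> lspan B (words distinct)" using Cons by simp
  show ?case
  proof (cases x)
    case (W w)
    then have "w \<in> G" using Cons.prems by (auto simp: generators_def)
    then show ?thesis using U_mult_lspan_words[OF _ IH] W split by simp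
  next
    case (E i)
    then have "i \<in> P" using Cons.prems by (auto simp: generators_def)
    then show ?thesis using e_mult_lspan_distinct[OF _ IH] E split by simp
  qed
qed

lemma carrier_B_subset_lspan: "carrier B \<subseteq> lspan B (words distinct)"
proof
  let ?u = "\<lambda>u. Poly_Mapping.single u 1"
  fix y assume "y \<in> carrier B"
  then obtain x where x: "x \<in> carrier F" "y = proj x" using carrier_presented B_eq by auto
  have "proj x \<in> lspan B (proj ` ?u ` {u. set u \<subseteq> X})"
    using x(1)
    by (intro algebra_hom_image_lspan[OF F.complex_algebra_axioms complex_algebra_B proj_alg_hom])
      (auto simp: carrier_free_algebra[symmetric], simp add: free_algebra_def free_monoid_def subset_iff)
  moreover have "proj ` ?u ` {u. set u \<subseteq> X} \<subseteq> lspan B (words distinct)"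
    using proj_word_in_lspan by auto
  ultimately show "y \<in> lspan B (words distinct)"
    using B.lspan_minimal[OF words_closed] x(2) by blast
qed

section \<open>The retraction onto the group algebra\<close>

lemma monoid_G: "monoid (GL scale\<lparr>carrier := G\<rparr>)"
  by (rule monoidI) (auto simp: comp_in_G id_in_G o_assoc)

sublocale C: complex_algebra C
  unfolding group_algebra_def by (rule monoid.complex_algebra_monoid_algebra[OF monoid_G])

lemma group_algebra_simps:
  "f \<in> carrier C \<longleftrightarrow> Poly_Mapping.keys f \<subseteq> G"
  "\<one>\<^bsub>C\<^esub> = Poly_Mapping.single id 1"
  "\<zero>\<^bsub>C\<^esub> = 0"
  "Poly_Mapping.single w c \<otimes>\<^bsub>C\<^esub> Poly_Mapping.single w' d = Poly_Mapping.single (w \<circ> w') (c * d)"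
  by (simp_all add: group_algebra_def)

lemma single_closed [simp]: "w \<in> G \<Longrightarrow> Poly_Mapping.single w c \<in> carrier C"
  by (simp add: group_algebra_simps)

text \<open>Defined on words because the free algebra is the monoid algebra of words; the point left
  to check is multiplicativity under concatenation.\<close>

fun retract_word :: "('v \<Rightarrow> 'v, 'p) generator list \<Rightarrow> ('v \<Rightarrow> 'v) \<Rightarrow>\<^sub>0 complex" where
  "retract_word [] = \<one>\<^bsub>C\<^esub>"
| "retract_word (W w # u) = Poly_Mapping.single w 1 \<otimes>\<^bsub>C\<^esub> retract_word u"
| "retract_word (E i # u) = \<zero>\<^bsub>C\<^esub>"

lemma retract_word_closed: "set u \<subseteq> X \<Longrightarrow> retract_word u \<in> carrier C"
proof (induction u rule: retract_word.induct)
  case (2 w u)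
  then have "Poly_Mapping.single w 1 \<in> carrier C" by (auto simp: generators_def)
  with 2 show ?case by simp
qed auto

lemma retract_word_append:
  "\<lbrakk>set u \<subseteq> X; set v \<subseteq> X\<rbrakk> \<Longrightarrow> retract_word (u @ v) = retract_word u \<otimes>\<^bsub>C\<^esub> retract_word v"
proof (induction u rule: retract_word.induct)
  case (2 w u)
  then have "Poly_Mapping.single w 1 \<in> carrier C" by (auto simp: generators_def)
  with 2 show ?case by (simp add: retract_word_closed C.m_assoc)
qed (simp_all add: retract_word_closed)

sublocale retraction: monoid_representation "free_monoid X" C retract_word
  by (intro monoid_representation.intro monoid_free_monoid C.complex_algebra_axioms
      monoid_representation_axioms.intro)
    (auto simp: free_monoid_def retract_word_append intro: retract_word_closed)

lemma retraction:
  obtains \<chi> where "\<chi> \<in> algebra_hom B C" "\<And>w. w \<in> G \<Longrightarrow> \<chi> (proj (w_gen w)) = Poly_Mapping.single w 1"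
proof -
  define \<psi> where "\<psi> = algebra_lift C retract_word"
  have \<psi>_hom: "\<psi> \<in> algebra_hom F C"
    unfolding \<psi>_def free_algebra_def by (rule retraction.algebra_lift_hom)
  note \<psi>_ring_hom = algebra_homD(1)[OF \<psi>_hom]
  interpret \<psi>: ring_hom_ring F C \<psi>
    by (intro ring_hom_ringI2 F.ring_axioms C.ring_axioms \<psi>_ring_hom)
  have \<psi>_gen: "\<psi> (free_gen x) = retract_word [x]" if "x \<in> X" for x
    using retraction.algebra_lift_single[of "[x]" 1] retract_word_closed[of "[x]"] that
    by (simp add: \<psi>_def free_gen_def free_monoid_def)
  have \<psi>_w: "\<psi> (w_gen w) = Poly_Mapping.single w 1" if "w \<in> G" for w
    using \<psi>_gen[of "W w"] that by (simp add: generators_def group_algebra_simps)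
  have \<psi>_e: "\<psi> (e_gen i) = \<zero>\<^bsub>C\<^esub>" if "i \<in> P" for i
    using \<psi>_gen[of "E i"] that by (simp add: generators_def)
  \<comment> \<open>\<open>group_one\<close> and \<open>group_mult\<close> become identities between
    group elements; both sides of every other relation are sent to zero.\<close>
  have "\<psi> l = \<psi> r" if "(l, r) \<in> S" for l r
    using that
    by cases (auto simp: \<psi>_w \<psi>_e id_in_G comp_in_G pseudo_reflections_def group_algebra_simps(2,4)
        algebra_homD(2)[OF \<psi>_hom])
  from presented_lift[OF C.complex_algebra_axioms \<psi>_hom this] obtain \<chi>
    where "\<chi> \<in> algebra_hom B C" "\<And>x. x \<in> carrier F \<Longrightarrow> \<chi> (proj x) = \<psi> x"
    unfolding B_eq by blast
  with \<psi>_w show thesis by (intro that[of \<chi>]) auto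
qed

text \<open>The retraction sends unit to unit and zero to zero, and these differ in the group
  algebra. This makes \<open>scalars B\<close> a subfield, so that a dimension over it can be
  taken.\<close>

lemma B_one_neq_zero: "\<one>\<^bsub>B\<^esub> \<noteq> \<zero>\<^bsub>B\<^esub>"
proof
  assume eq: "\<one>\<^bsub>B\<^esub> = \<zero>\<^bsub>B\<^esub>"
  obtain \<chi> where "\<chi> \<in> algebra_hom B C" by (rule retraction)
  then have "\<one>\<^bsub>C\<^esub> = \<zero>\<^bsub>C\<^esub>"
    using ring_hom_one ring_hom_zero[OF _ B.ring_axioms C.ring_axioms] algebra_homD(1) eq by metis
  then show False by (simp add: group_algebra_simps) (metis lookup_single_eq lookup_zero zero_neq_one)
qed

section \<open>Finite dimension and the embedding of the group algebra\<close>

lemma finite_dimensional_B: "finite_dimensional_algebra B"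
  using finite_words_distinct finite_G finite_P
  by (intro B.finite_dimensional_algebraI[OF B_one_neq_zero _ words_closed carrier_B_subset_lspan]) auto

sublocale bar: monoid_representation "GL scale\<lparr>carrier := G\<rparr>" B "B_bar scale G P H \<mu> m"
  by (intro monoid_representation.intro monoid_G complex_algebra_B monoid_representation_axioms.intro)
    (auto simp: proj_gens[symmetric] proj_w_id proj_w_mult simp del: B.one_closed)

text \<open>The retraction is a left inverse of the induced map, so no linear independence has to be
  proved inside the quotient.\<close>

lemma group_algebra_embedding:
  "\<exists>\<phi>\<in>algebra_hom C B. (\<forall>w\<in>G. \<phi> (Poly_Mapping.single w 1) = B_bar scale G P H \<mu> m w)
    \<and> inj_on \<phi> (carrier C)"
proof -
  define \<phi> where "\<phi> = algebra_lift B (B_bar scale G P H \<mu> m)"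
  have \<phi>_hom: "\<phi> \<in> algebra_hom C B"
    unfolding \<phi>_def group_algebra_def by (rule bar.algebra_lift_hom)
  have \<phi>_single: "\<phi> (Poly_Mapping.single w 1) = B_bar scale G P H \<mu> m w" if "w \<in> G" for w
    using bar.algebra_lift_single[of w 1] bar.closed[of w] that by (simp add: \<phi>_def)
  obtain \<chi> where \<chi>: "\<chi> \<in> algebra_hom B C"
    "\<And>w. w \<in> G \<Longrightarrow> \<chi> (proj (w_gen w)) = Poly_Mapping.single w 1"
    by (rule retraction) blast
  note hom = algebra_homD[OF \<phi>_hom] algebra_homD[OF \<chi>(1)]
  have comp: "\<chi> \<circ> \<phi> \<in> algebra_hom C C"
    using ring_hom_trans[OF hom(1,3)] hom ring_hom_closed[OF hom(1)] by (intro algebra_homI) auto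
  have id: "id \<in> algebra_hom C C"
    by (intro algebra_homI ring_hom_memI) auto
  have "\<chi> (\<phi> f) = f" if "f \<in> carrier C" for f
  proof -
    \<comment> \<open>Both sides are algebra homomorphisms in \<open>f\<close>, and the group
      elements span, so agreement on group elements is enough.\<close>
    have "(\<chi> \<circ> \<phi>) f = id f"
    proof (rule algebra_hom_eq_on_lspan[OF C.complex_algebra_axioms C.complex_algebra_axioms comp id])
      show "f \<in> lspan C ((\<lambda>w. Poly_Mapping.single w 1) ` G)"
        using that monoid.carrier_monoid_algebra_eq_lspan[OF monoid_G] by (simp add: group_algebra_def)
    qed (auto simp: \<phi>_single proj_gens[symmetric] \<chi>(2))
    then show ?thesis by simp
  qed
  then have "inj_on \<phi> (carrier C)" by (rule inj_on_inverseI)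
  with \<phi>_hom \<phi>_single show ?thesis by blast
qed

end

theorem theorem5p1:
  fixes scale :: "complex \<Rightarrow> 'v::ab_group_add \<Rightarrow> 'v"
    and G :: "('v \<Rightarrow> 'v) set"
    and P :: "'p set"
    and H :: "'p \<Rightarrow> 'v set"
    and \<mu> :: "('v \<Rightarrow> 'v) \<Rightarrow> complex"
    and m :: "'p \<Rightarrow> complex"
  assumes "finite_pseudo_reflection_group scale G"
    and "bij_betw H P (reflection_hyperplanes scale G)"
    and "admissible_parameters scale G P H \<mu> m"
  shows "finite_dimensional_algebra (B_algebra scale G P H \<mu> m) \<and>
         (\<exists>\<phi> \<in> algebra_hom (group_algebra scale G) (B_algebra scale G P H \<mu> m).
            (\<forall>w\<in>G. \<phi> (Poly_Mapping.single w 1) = B_bar scale G P H \<mu> m w) \<and>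
            inj_on \<phi> (carrier (group_algebra scale G)))"
proof -
  interpret reflection_setting scale G P H \<mu> m
    using assms(1,2) by (rule reflection_setting.intro)
  show ?thesis
    using finite_dimensional_B group_algebra_embedding by blast
qed

end
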